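(* There exists a sequence of piecewise smooth, closed curves $\gamma_t:[0,1]\to\mathbb{S}^2$, $t=1,2,3,\dots$, of length $\ell(\gamma_t)\asymp t$ (i.e. there are constants $0<c\le C$ independent of $t$ with $c\,t\le\ell(\gamma_t)\le C\,t$ for all $t\ge1$), such that for every $t\ge 1$ $$\frac{1}{\ell(\gamma_t)}\int_{\gamma_t}f=\int_{\mathbb{S}^2}f\qquad\text{for all } f\in\Pi_t,$$ and the trajectory $\gamma_t([0,1])$ of every $\gamma_t$ is a union of Euclidean circles.
   Context: $\mathbb{S}^2=\{x\in\mathbb{R}^{3}:\|x\|=1\}$, and $\int_{\mathbb{S}^2}$ denotes integration with respect to the surface measure normalized so that $\int_{\mathbb{S}^2}1=1$. $\Pi_t$ is the space of algebraic polynomials in $3$ real variables of total degree at most $t$. A curve is a continuous, piecewise smooth map $\gamma:[0,1]\to\mathbb{S}^2$ with at most finitely many self-intersections (all but finitely many points of $\gamma([0,1))$ are attained exactly once on $[0,1)$); it is closed if $\gamma(0)=\gamma(1)$. Its length is $\ell(\gamma)=\int_0^1\|\dot\gamma(s)\|\,ds$, assumed positive, and $\int_\gamma f=\int_0^1 f(\gamma(s))\|\dot\gamma(s)\|\,ds$. A Euclidean circle in $\mathbb{S}^2$ is a circle of positive radius, i.e. the intersection of $\mathbb{S}^2$ with an affine plane of $\mathbb{R}^3$ when this intersection has more than one point. *)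

theory Defs
  imports "HOL-Analysis.Analysis"
begin

section \<open>Normalized surface measure on the unit sphere\<close>

definition spherical_coords :: "real \<times> real \<Rightarrow> real^3" where
  "spherical_coords = (\<lambda>(\<theta>, \<phi>). vector [sin \<theta> * cos \<phi>, sin \<theta> * sin \<phi>, cos \<theta>])"

definition area_element :: "real \<times> real \<Rightarrow> real" where
  "area_element = (\<lambda>(\<theta>, \<phi>). norm (cross3
     (vector_derivative (\<lambda>s. spherical_coords (s, \<phi>)) (at \<theta>))
     (vector_derivative (\<lambda>s. spherical_coords (\<theta>, s)) (at \<phi>))))"

text \<open>The coordinates parametrize the sphere injectively up to a null set of the parameter
  rectangle, so the pushforward of the area element is the surface measure (carried by the sphere,
  as a Borel measure on the ambient space).\<close>

definition surface_measure :: "(real^3) measure" where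
  "surface_measure = distr
     (density (restrict_space lborel (cbox (0, 0) (pi, 2 * pi))) (\<lambda>p. ennreal (area_element p)))
     borel spherical_coords"

definition normalized_surface_measure :: "(real^3) measure" where
  "normalized_surface_measure = uniform_measure surface_measure (sphere 0 1)"


section \<open>Polynomials of bounded total degree\<close>

text \<open>\<open>poly_space t\<close> is \<open>\<Pi>\<^sub>t\<close>, as functions on the whole space; \<open>\<alpha>\<close> ranges over the multi-indices of
  order at most \<open>t\<close>, a finite set by \<open>finite_multi_indices\<close> below.\<close>

definition poly_space :: "nat \<Rightarrow> (real^3 \<Rightarrow> real) set" where
  "poly_space t = {f. \<exists>c :: (3 \<Rightarrow> nat) \<Rightarrow> real.
     f = (\<lambda>x. \<Sum>\<alpha> | (\<Sum>i\<in>UNIV. \<alpha> i) \<le> t. c \<alpha> * (\<Prod>i\<in>UNIV. (x $ i) ^ \<alpha> i))}"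


section \<open>Curves\<close>

text \<open>\<open>C\<^sup>\<infinity>\<close> up to and including the end points, with one-sided derivatives there;
  \<open>D k\<close> is the derivative of order \<open>k\<close>.\<close>

definition smooth_on_interval :: "(real \<Rightarrow> 'a::real_normed_vector) \<Rightarrow> real \<Rightarrow> real \<Rightarrow> bool" where
  "smooth_on_interval g a b \<longleftrightarrow> (\<exists>D :: nat \<Rightarrow> real \<Rightarrow> 'a. D 0 = g \<and>
     (\<forall>k. \<forall>s\<in>{a..b}. (D k has_vector_derivative D (Suc k) s) (at s within {a..b})))"

definition piecewise_smooth :: "(real \<Rightarrow> 'a::real_normed_vector) \<Rightarrow> bool" where
  "piecewise_smooth g \<longleftrightarrow> (\<exists>(n::nat) (p :: nat \<Rightarrow> real). p 0 = 0 \<and> p n = 1 \<and>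
     (\<forall>i<n. p i < p (Suc i) \<and> smooth_on_interval g (p i) (p (Suc i))))"

definition finitely_many_self_intersections :: "(real \<Rightarrow> 'a) \<Rightarrow> bool" where
  "finitely_many_self_intersections g \<longleftrightarrow>
     finite {x \<in> g ` {0..<1}. \<not> (\<exists>!s. s \<in> {0..<1} \<and> g s = x)}"

text \<open>The derivative is unspecified at the finitely many break points, which are negligible for
  the integrals.\<close>

definition curve_length :: "(real \<Rightarrow> 'a::real_normed_vector) \<Rightarrow> real" where
  "curve_length g = integral {0..1} (\<lambda>s. norm (vector_derivative g (at s within {0..1})))"

definition curve_integral :: "(real \<Rightarrow> 'a::real_normed_vector) \<Rightarrow> ('a \<Rightarrow> real) \<Rightarrow> real" where
  "curve_integral g f =
     integral {0..1} (\<lambda>s. f (g s) * norm (vector_derivative g (at s within {0..1})))"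

definition sphere_curve :: "(real \<Rightarrow> real^3) \<Rightarrow> bool" where
  "sphere_curve g \<longleftrightarrow> path g \<and> path_image g \<subseteq> sphere 0 1 \<and> piecewise_smooth g \<and>
     finitely_many_self_intersections g \<and> curve_length g > 0"

definition closed_curve :: "(real \<Rightarrow> 'a::topological_space) \<Rightarrow> bool" where
  "closed_curve g \<longleftrightarrow> pathfinish g = pathstart g"


section \<open>Euclidean circles in the sphere\<close>

definition euclidean_circle :: "(real^3) set \<Rightarrow> bool" where
  "euclidean_circle C \<longleftrightarrow> (\<exists>P. affine P \<and> aff_dim P = 2 \<and> C = sphere 0 1 \<inter> P) \<and>
     (\<exists>x\<in>C. \<exists>y\<in>C. x \<noteq> y)"


section \<open>Basic facts\<close>

lemma finite_multi_indices: "finite {\<alpha> :: 3 \<Rightarrow> nat. (\<Sum>i\<in>UNIV. \<alpha> i) \<le> t}"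
proof (rule finite_subset)
  show "{\<alpha> :: 3 \<Rightarrow> nat. (\<Sum>i\<in>UNIV. \<alpha> i) \<le> t} \<subseteq> PiE UNIV (\<lambda>_. {..t})"
  proof
    fix \<alpha> :: "3 \<Rightarrow> nat" assume "\<alpha> \<in> {\<alpha>. (\<Sum>i\<in>UNIV. \<alpha> i) \<le> t}"
    then have "\<alpha> i \<le> t" for i
      using member_le_sum[of i UNIV \<alpha>] by force
    then show "\<alpha> \<in> PiE UNIV (\<lambda>_. {..t})" by (auto simp: PiE_def)
  qed
qed (auto intro: finite_PiE)

lemma has_vector_derivative_vector3:
  assumes "(f has_real_derivative f') (at x)" "(g has_real_derivative g') (at x)"
    "(h has_real_derivative h') (at x)"
  shows "((\<lambda>s. vector [f s, g s, h s] :: real^3) has_vector_derivative vector [f', g', h']) (at x)"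
proof -
  have eq: "(vector [a, b, c] :: real^3) = a *\<^sub>R axis 1 1 + b *\<^sub>R axis 2 1 + c *\<^sub>R axis 3 1" for a b c
    by (simp add: vec_eq_iff forall_3 axis_def)
  show ?thesis
    unfolding eq
    by (intro has_vector_derivative_add has_vector_derivative_scaleR[where g' = 0, simplified]
          assms has_vector_derivative_const)
qed

lemma spherical_coords_in_sphere: "spherical_coords p \<in> sphere 0 1"
proof (cases p)
  case (Pair \<theta> \<phi>)
  have "(sin \<theta> * cos \<phi>) * (sin \<theta> * cos \<phi>) + (sin \<theta> * sin \<phi>) * (sin \<theta> * sin \<phi>) +
      cos \<theta> * cos \<theta> = 1"
    using sin_cos_squared_add[of \<phi>] sin_cos_squared_add[of \<theta>] by algebra
  then show ?thesis
    by (simp add: Pair norm_eq_sqrt_inner inner_vec_def sum_3 spherical_coords_def)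
qed

lemma area_element_eq: "area_element (\<theta>, \<phi>) = \<bar>sin \<theta>\<bar>"
proof -
  have 1: "vector_derivative (\<lambda>s. spherical_coords (s, \<phi>)) (at \<theta>) =
      vector [cos \<theta> * cos \<phi>, cos \<theta> * sin \<phi>, - sin \<theta>]"
    unfolding spherical_coords_def prod.case
    by (intro vector_derivative_at has_vector_derivative_vector3) (auto intro!: derivative_eq_intros)
  have 2: "vector_derivative (\<lambda>s. spherical_coords (\<theta>, s)) (at \<phi>) =
      vector [- (sin \<theta> * sin \<phi>), sin \<theta> * cos \<phi>, 0]"
    unfolding spherical_coords_def prod.case
    by (intro vector_derivative_at has_vector_derivative_vector3) (auto intro!: derivative_eq_intros)
  have "cross3 (vector [cos \<theta> * cos \<phi>, cos \<theta> * sin \<phi>, - sin \<theta>])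
      (vector [- (sin \<theta> * sin \<phi>), sin \<theta> * cos \<phi>, 0]) = sin \<theta> *\<^sub>R spherical_coords (\<theta>, \<phi>)"
  proof -
    have "cos \<phi> * (cos \<theta> * (cos \<phi> * sin \<theta>)) + cos \<theta> * (sin \<phi> * (sin \<phi> * sin \<theta>)) =
        cos \<theta> * sin \<theta>"
      using sin_cos_squared_add[of \<phi>] by algebra
    then show ?thesis
      by (simp add: cross3_def spherical_coords_def vec_eq_iff forall_3 ac_simps)
  qed
  then show ?thesis
    using spherical_coords_in_sphere[of "(\<theta>, \<phi>)"] by (simp add: area_element_def 1 2)
qed

lemma spherical_coords_measurable [measurable]: "spherical_coords \<in> borel_measurable borel"
proof -
  have eq: "spherical_coords = (\<lambda>p. (sin (fst p) * cos (snd p)) *\<^sub>R axis 1 1 +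
      (sin (fst p) * sin (snd p)) *\<^sub>R axis 2 1 + cos (fst p) *\<^sub>R axis 3 1)"
    by (auto simp: spherical_coords_def vec_eq_iff forall_3 axis_def)
  show ?thesis
    unfolding eq by (auto intro!: borel_measurable_continuous_onI continuous_intros)
qed

lemma area_element_measurable [measurable]: "area_element \<in> borel_measurable borel"
proof -
  have eq: "area_element = (\<lambda>p. \<bar>sin (fst p)\<bar>)"
    by (auto simp: area_element_eq)
  show ?thesis
    unfolding eq by (auto intro!: borel_measurable_continuous_onI continuous_intros)
qed

lemma emeasure_surface_measure_sphere: "emeasure surface_measure (sphere 0 1) = ennreal (4 * pi)"
proof -
  let ?R = "cbox (0::real, 0::real) (pi, 2 * pi)"
  have "emeasure surface_measure (sphere 0 1) = (\<integral>\<^sup>+p. ennreal (area_element p) * indicator ?R p \<partial>lborel)"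
  proof -
    have m: "spherical_coords \<in> density (restrict_space lborel ?R) (\<lambda>p. ennreal (area_element p))
        \<rightarrow>\<^sub>M borel"
      by (simp add: measurable_restrict_space1)
    have a: "(\<lambda>p. ennreal (area_element p)) \<in> borel_measurable (restrict_space lborel ?R)"
      by (intro measurable_restrict_space1) simp
    have "emeasure surface_measure (sphere 0 1) =
        emeasure (density (restrict_space lborel ?R) (\<lambda>p. ennreal (area_element p))) ?R"
    proof -
      have "spherical_coords -` sphere 0 1 = UNIV"
        using spherical_coords_in_sphere by blast
      then show ?thesis
        unfolding surface_measure_def by (subst emeasure_distr[OF m]) (simp_all add: space_restrict_space)
    qed
    also have "\<dots> = (\<integral>\<^sup>+p. ennreal (area_element p) * indicator ?R p \<partial>restrict_space lborel ?R)"
      by (rule emeasure_density[OF a]) (auto simp: sets_restrict_space)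
    also have "\<dots> = (\<integral>\<^sup>+p. ennreal (area_element p) * indicator ?R p * indicator ?R p \<partial>lborel)"
      by (rule nn_integral_restrict_space) simp
    also have "\<dots> = (\<integral>\<^sup>+p. ennreal (area_element p) * indicator ?R p \<partial>lborel)"
      by (rule nn_integral_cong) (auto simp: indicator_def)
    finally show ?thesis .
  qed
  also have "\<dots> = (\<integral>\<^sup>+p. ennreal (area_element p) * indicator ?R p \<partial>(lborel \<Otimes>\<^sub>M lborel))"
    by (simp add: lborel_prod)
  also have "\<dots> = (\<integral>\<^sup>+\<theta>. \<integral>\<^sup>+\<phi>. ennreal (area_element (\<theta>, \<phi>)) * indicator ?R (\<theta>, \<phi>) \<partial>lborel \<partial>lborel)"
    by (subst lborel.nn_integral_fst[symmetric]) (simp_all add: lborel_prod)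
  also have "\<dots> = (\<integral>\<^sup>+\<theta>. (ennreal (sin \<theta>) * indicator {0..pi} \<theta>) * ennreal (2 * pi) \<partial>lborel)"
  proof (rule nn_integral_cong)
    fix \<theta> :: real
    have "(\<integral>\<^sup>+\<phi>. ennreal (area_element (\<theta>, \<phi>)) * indicator ?R (\<theta>, \<phi>) \<partial>lborel) =
        (\<integral>\<^sup>+\<phi>. (ennreal (sin \<theta>) * indicator {0..pi} \<theta>) * indicator {0..2 * pi} \<phi> \<partial>lborel)"
      by (intro nn_integral_cong) (auto simp: area_element_eq cbox_Pair_eq sin_ge_zero indicator_def)
    also have "\<dots> = (ennreal (sin \<theta>) * indicator {0..pi} \<theta>) * ennreal (2 * pi)"
      by (subst nn_integral_cmult) auto
    finally show "(\<integral>\<^sup>+\<phi>. ennreal (area_element (\<theta>, \<phi>)) * indicator ?R (\<theta>, \<phi>) \<partial>lborel) = \<dots>" .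
  qed
  also have "\<dots> = ennreal (2 * pi) * (\<integral>\<^sup>+\<theta>. ennreal (sin \<theta>) * indicator {0..pi} \<theta> \<partial>lborel)"
    by (subst nn_integral_cmult[symmetric]) (auto simp: mult.commute)
  also have "(\<integral>\<^sup>+\<theta>. ennreal (sin \<theta>) * indicator {0..pi} \<theta> \<partial>lborel) = ennreal (- cos pi - (- cos 0))"
    by (rule nn_integral_FTC_Icc[where F = "\<lambda>x. - cos x"])
      (auto intro!: derivative_eq_intros sin_ge_zero)
  also have "ennreal (2 * pi) * ennreal (- cos pi - (- cos 0)) = ennreal (4 * pi)"
    by (subst ennreal_mult[symmetric]) auto
  finally show ?thesis .
qed

end

theory Submission
  imports Defs
begin

text \<open>
  The curve for degree \<open>t\<close> runs once through each of \<open>2 N\<close> circles, where \<open>N = 32 (t + 1) + 1\<close>: the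
  latitude circles of colatitudes \<open>y\<^sub>0, \<dots>, y\<^sub>N\<^sub>-\<^sub>1\<close> about the third coordinate axis, and the latitude
  circles with the same colatitudes about the first axis.

  On the sphere, averaging a polynomial of degree at most \<open>t\<close> over the rotations about an axis leaves a
  polynomial of degree at most \<open>t\<close> in the height \<open>cos \<theta>\<close>, and the circle of colatitude \<open>\<theta>\<close> has length
  \<open>2 \<pi> sin \<theta>\<close>. So one family of circles is exact as soon as all points \<open>y\<^sub>j\<close>, with \<^emph>\<open>equal\<close> weights, integrate \<open>sin \<theta> q(cos \<theta>)\<close> over \<open>[0, \<pi>]\<close>
  for every polynomial \<open>q\<close> of degree at most \<open>t\<close>. These functions are spanned by
  \<open>sin \<theta>, \<dots>, sin ((t + 1) \<theta>)\<close>. Equal weights are forced, because the curve may pass through each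
  circle only once.

  Such points exist (\<open>equal_weight_sine_quadrature\<close>). Cut \<open>[0, \<pi>]\<close> into \<open>N\<close> equal cells, restrict
  \<open>y\<^sub>j\<close> to the middle half of cell \<open>j\<close>, and minimize the sum of the squares of the quadrature errors of
  \<open>sin (k \<theta>)\<close>. Let \<open>P\<close> be the sine polynomial whose coefficients are the errors at a minimizer. Then the
  minimum is the quadrature error of \<open>P\<close> itself, while the gradient of the minimized sum is a positive multiple of
  \<open>(P'(y\<^sub>0), \<dots>, P'(y\<^sub>N\<^sub>-\<^sub>1))\<close>. The minimum is taken over a box, so wherever \<open>P'(y\<^sub>j) \<noteq> 0\<close> the point
  \<open>y\<^sub>j\<close> has been pushed against the end of its range in the direction in which \<open>P\<close> descends. This makes the
  quadrature error of \<open>P\<close> smaller than that of the midpoint rule by about a quarter of \<open>h \<integral> \<bar>P'\<bar>\<close>,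
  where \<open>h = \<pi> / N\<close>; all other contributions are at most \<open>h\<^sup>2 \<integral> \<bar>P''\<bar>\<close>
  (\<open>descending_node_estimate\<close>). By the Bernstein inequality in \<open>L\<^sup>1\<close> (\<open>bernstein_L1\<close>) the gain
  dominates once \<open>N\<close> is a large multiple of \<open>t + 1\<close>. So the minimum, a sum of squares, is at most zero,
  and all errors vanish.

  One family would give disjoint circles. The second family makes the union connected: the cell count is odd,
  so one circle of each family is so close to the equator that it meets all circles of the other
  family. Exactness of the second family follows because the moments of the sphere are symmetric in the
  coordinates (\<open>sphere_moment_swap\<close>). Finally, two closed curves with at least one and only finitely many common points can be joined into one
  closed curve (\<open>traverses_join\<close>), so the circles are inserted one after the other, each
  traversed exactly once. The total length is \<open>8 N\<close>.
\<close>

section \<open>The Bernstein inequality in the mean\<close>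

lemma sum_swap_triple:
  "(\<Sum>r\<in>A. \<Sum>l\<in>B. \<Sum>m\<in>C. f r l m) = (\<Sum>l\<in>B. \<Sum>m\<in>C. \<Sum>r\<in>A. f r l m)"
  by (rule trans[OF sum.swap]) (intro sum.cong refl sum.swap)

text \<open>A geometric sum over a root of unity different from \<open>1\<close>.\<close>

lemma sum_cis_roots_of_unity:
  fixes a :: int
  assumes "a \<noteq> 0" "\<bar>a\<bar> < int M"
  shows "(\<Sum>r<M. cis (of_int a * (2 * pi * real r / real M))) = 0"
proof -
  have M: "M > 0" using assms by linarith
  let ?z = "cis (2 * pi * of_int a / real M)"
  have z: "?z \<noteq> 1"
  proof
    assume "?z = 1"
    then obtain m :: int where "2 * pi * of_int a / real M = of_int (2 * m) * pi"
      by (auto simp: complex_eq_iff cos_one_2pi_int mult_ac)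
    then have "real_of_int a = of_int (m * int M)" using M by (simp add: field_simps)
    then have "a = m * int M" by linarith
    then show False using assms by (simp add: abs_mult)
  qed
  have "(\<Sum>r<M. cis (of_int a * (2 * pi * real r / real M))) = (\<Sum>r<M. ?z ^ r)"
    by (intro sum.cong refl, subst Complex.DeMoivre) (simp add: mult_ac)
  also have "\<dots> = (?z ^ M - 1) / (?z - 1)" using z by (rule geometric_sum)
  also have "?z ^ M = 1"
    using M cis_multiple_2pi[of "of_int a"] by (subst Complex.DeMoivre) (simp add: mult_ac)
  finally show ?thesis by simp
qed

lemma sum_cos_equispaced:
  fixes a :: int
  assumes "\<bar>a\<bar> < int M"
  shows "(\<Sum>r<M. cos (of_int a * (2 * pi * real r / real M))) = (if a = 0 then real M else 0)"
  using arg_cong[OF sum_cis_roots_of_unity, of a M Re] assms by (auto simp: Re_sum)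

lemma sum_sin_equispaced:
  fixes a :: int
  assumes "\<bar>a\<bar> < int M"
  shows "(\<Sum>r<M. sin (of_int a * (2 * pi * real r / real M))) = 0"
  using arg_cong[OF sum_cis_roots_of_unity, of a M Im] assms by (cases "a = 0") (auto simp: Im_sum)

text \<open>For trigonometric polynomials of degree at most \<open>n\<close>, differentiation is a finite combination of
  translations by \<open>u r\<close> whose coefficients \<open>lam r\<close> have absolute sum at most \<open>2 n\<close>. The coefficients are
  the samples at \<open>3 n\<close> equispaced points of \<open>2 n sin (n x) K(x)\<close>, where \<open>K\<close> is the Fejer kernel of order \<open>n\<close>,
  divided by the number of points. The factor \<open>sin (n x)\<close> turns the triangular Fourier coefficients of \<open>K\<close>
  into the difference of their shifts by \<open>\<plusminus>n\<close>; this is linear on \<open>{-n..n}\<close>, like the multiplier of the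
  derivative. The bound holds because \<open>K\<close> is nonnegative with mean \<open>1\<close>.\<close>

lemma finite_difference_kernel:
  fixes n :: nat
  assumes n: "n \<ge> 1"
  shows "\<exists>(M :: nat) (u :: nat \<Rightarrow> real) (lam :: nat \<Rightarrow> real).
    (\<forall>r<M. 0 \<le> u r \<and> u r \<le> 2 * pi) \<and> (\<Sum>r<M. \<bar>lam r\<bar>) \<le> 2 * real n \<and>
    (\<forall>k\<in>{1..n}. (\<Sum>r<M. lam r * cos (real k * u r)) = 0 \<and>
      (\<Sum>r<M. lam r * sin (real k * u r)) = real k)"
proof -
  define M where "M = 3 * n"
  define u where "u r = 2 * pi * real r / real M" for r
  define F where "F x = (\<Sum>l<n. \<Sum>m<n. cos (of_int (int l - int m) * x))" for x :: real
  define lam where "lam r = 2 / real M * (sin (real n * u r) * F (u r))" for r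
  have M0: "real M > 0" using n by (simp add: M_def)
  \<comment> \<open>\<open>F x\<close> is the squared modulus of \<open>\<Sum>l<n. exp (\<i> l x)\<close>.\<close>
  have Feq: "F x = (\<Sum>l<n. cos (real l * x))\<^sup>2 + (\<Sum>l<n. sin (real l * x))\<^sup>2" for x
    by (simp add: F_def power2_eq_square sum_product cos_diff left_diff_distrib flip: sum.distrib)
  have F0: "F x \<ge> 0" for x by (simp add: Feq)
  have C: "(\<Sum>r<M. cos (of_int a * u r)) = (if a = 0 then real M else 0)" if "\<bar>a\<bar> < int M" for a
    using sum_cos_equispaced[OF that] by (simp add: u_def)
  have S: "(\<Sum>r<M. sin (of_int a * u r)) = 0" if "\<bar>a\<bar> < int M" for a
    using sum_sin_equispaced[OF that] by (simp add: u_def)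
  have lam_eq: "lam r * c = 2 / real M * (sin (real n * u r) * F (u r) * c)" for r c
    by (simp add: lam_def)
  show ?thesis
  proof (intro exI conjI ballI allI impI)
    show "0 \<le> u r" "u r \<le> 2 * pi" if "r < M" for r
      using that M0 by (simp_all add: u_def field_simps)
    have "(\<Sum>r<M. F (u r)) = (\<Sum>l<n. \<Sum>m<n. \<Sum>r<M. cos (of_int (int l - int m) * u r))"
      unfolding F_def by (rule sum_swap_triple)
    also have "\<dots> = (\<Sum>l<n. \<Sum>m<n. if m = l then real M else 0)"
      by (intro sum.cong refl, subst C) (auto simp: M_def)
    also have "\<dots> = real n * real M" by simp
    finally have sF: "(\<Sum>r<M. F (u r)) = real n * real M" .
    have "(\<Sum>r<M. \<bar>lam r\<bar>) \<le> (\<Sum>r<M. 2 / real M * F (u r))"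
    proof (intro sum_mono)
      fix r
      have "\<bar>sin (real n * u r)\<bar> * F (u r) \<le> 1 * F (u r)"
        by (intro mult_right_mono abs_sin_le_one F0)
      then show "\<bar>lam r\<bar> \<le> 2 / real M * F (u r)"
        using M0 F0[of "u r"] unfolding lam_def abs_mult by (simp add: divide_right_mono)
    qed
    also have "\<dots> = 2 * real n" unfolding sum_distrib_left[symmetric] sF using M0 by simp
    finally show "(\<Sum>r<M. \<bar>lam r\<bar>) \<le> 2 * real n" .
  next
    fix k assume "k \<in> {1..n}"
    then have k: "1 \<le> k" "k \<le> n" by auto
    have "sin (real n * x) * F x * cos (real k * x) = 1 / 4 * (\<Sum>l<n. \<Sum>m<n.
        sin (of_int (int n + int k + (int l - int m)) * x) + sin (of_int (int n + int k - (int l - int m)) * x) +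
        (sin (of_int (int n - int k + (int l - int m)) * x) + sin (of_int (int n - int k - (int l - int m)) * x)))" for x
      unfolding F_def sum_distrib_left sum_distrib_right
      by (intro sum.cong refl)
        (simp add: sin_add sin_diff cos_add cos_diff ring_distribs algebra_simps)
    then have "(\<Sum>r<M. lam r * cos (real k * u r)) = 2 / real M * (1 / 4 * (\<Sum>r<M. \<Sum>l<n. \<Sum>m<n.
        sin (of_int (int n + int k + (int l - int m)) * u r) + sin (of_int (int n + int k - (int l - int m)) * u r) +
        (sin (of_int (int n - int k + (int l - int m)) * u r) + sin (of_int (int n - int k - (int l - int m)) * u r))))"
      by (simp only: lam_eq sum_distrib_left[symmetric])
    also have "(\<Sum>r<M. \<Sum>l<n. \<Sum>m<n.
        sin (of_int (int n + int k + (int l - int m)) * u r) + sin (of_int (int n + int k - (int l - int m)) * u r) +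
        (sin (of_int (int n - int k + (int l - int m)) * u r) + sin (of_int (int n - int k - (int l - int m)) * u r)))
      = (\<Sum>l<n. \<Sum>m<n. \<Sum>r<M.
        sin (of_int (int n + int k + (int l - int m)) * u r) + sin (of_int (int n + int k - (int l - int m)) * u r) +
        (sin (of_int (int n - int k + (int l - int m)) * u r) + sin (of_int (int n - int k - (int l - int m)) * u r)))"
      by (rule sum_swap_triple)
    also have "\<dots> = (\<Sum>l<n. \<Sum>m<n. 0)"
    proof (intro sum.cong refl)
      fix l m assume lm: "l \<in> {..<n}" "m \<in> {..<n}"
        have b: "\<bar>int n + int k + (int l - int m)\<bar> < int M" "\<bar>int n + int k - (int l - int m)\<bar> < int M"
          "\<bar>int n - int k + (int l - int m)\<bar> < int M" "\<bar>int n - int k - (int l - int m)\<bar> < int M"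
          using k lm by (auto simp: M_def)
      show "(\<Sum>r<M.
        sin (of_int (int n + int k + (int l - int m)) * u r) + sin (of_int (int n + int k - (int l - int m)) * u r) +
        (sin (of_int (int n - int k + (int l - int m)) * u r) + sin (of_int (int n - int k - (int l - int m)) * u r))) = 0"
        by (simp only: sum.distrib S[OF b(1)] S[OF b(2)] S[OF b(3)] S[OF b(4)])
    qed
    finally show "(\<Sum>r<M. lam r * cos (real k * u r)) = 0" by simp
  next
    fix k assume "k \<in> {1..n}"
    then have k: "1 \<le> k" "k \<le> n" by auto
    let ?t = "\<lambda>l m x. cos (of_int (int n - int k + (int l - int m)) * x)
        + cos (of_int (int n - int k - (int l - int m)) * x)
        - (cos (of_int (int n + int k + (int l - int m)) * x)
        + cos (of_int (int n + int k - (int l - int m)) * x))"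
    have "sin (real n * x) * F x * sin (real k * x) = 1 / 4 * (\<Sum>l<n. \<Sum>m<n. ?t l m x)" for x
      unfolding F_def sum_distrib_left sum_distrib_right
      by (intro sum.cong refl)
        (simp add: sin_add sin_diff cos_add cos_diff ring_distribs algebra_simps)
    then have "(\<Sum>r<M. lam r * sin (real k * u r)) =
        2 / real M * (1 / 4 * (\<Sum>r<M. \<Sum>l<n. \<Sum>m<n. ?t l m (u r)))"
      by (simp only: lam_eq sum_distrib_left[symmetric])
    also have "(\<Sum>r<M. \<Sum>l<n. \<Sum>m<n. ?t l m (u r)) = (\<Sum>l<n. \<Sum>m<n. \<Sum>r<M. ?t l m (u r))"
      by (rule sum_swap_triple)
    \<comment> \<open>All frequencies are smaller than \<open>M\<close>, so only the frequency \<open>0\<close> survives the summation over \<open>r\<close>.\<close>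
    also have "\<dots> = (\<Sum>l<n. \<Sum>m<n. (if m = l + (n - k) then real M else 0) +
        (if l = m + (n - k) then real M else 0))"
    proof (intro sum.cong refl)
      fix l m assume lm: "l \<in> {..<n}" "m \<in> {..<n}"
        have b: "\<bar>int n + int k + (int l - int m)\<bar> < int M" "\<bar>int n + int k - (int l - int m)\<bar> < int M"
          "\<bar>int n - int k + (int l - int m)\<bar> < int M" "\<bar>int n - int k - (int l - int m)\<bar> < int M"
          using k lm by (auto simp: M_def)
      show "(\<Sum>r<M. ?t l m (u r)) = (if m = l + (n - k) then real M else 0) +
        (if l = m + (n - k) then real M else 0)"
        unfolding sum.distrib sum_subtractf C[OF b(1)] C[OF b(2)] C[OF b(3)] C[OF b(4)]
        using k lm by auto
    qed
    also have "\<dots> = (\<Sum>l<n. \<Sum>m<n. if m = l + (n - k) then real M else 0) +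
        (\<Sum>m<n. \<Sum>l<n. if l = m + (n - k) then real M else 0)"
      unfolding sum.distrib by (rule arg_cong2[where f = "(+)", OF refl sum.swap])
    also have "\<dots> = 2 * (\<Sum>l<n. if l < k then real M else 0)"
    proof -
      have "(\<Sum>m<n. if m = l + (n - k) then real M else 0) = (if l < k then real M else 0)" for l
        using k by (auto simp: sum.delta)
      then show ?thesis by simp
    qed
    also have "(\<Sum>l<n. if l < k then real M else 0) = real k * real M"
    proof -
      have "(\<Sum>l<n. if l < k then real M else 0) = (\<Sum>l\<in>{..<n} \<inter> {l. l < k}. real M)"
        by (simp add: sum.If_cases)
      also have "{..<n} \<inter> {l. l < k} = {..<k}" using k by auto
      finally show ?thesis by simp
    qed
    finally show "(\<Sum>r<M. lam r * sin (real k * u r)) = real k"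
      using M0 by simp
  qed
qed

lemma integral_period_shift:
  fixes f :: "real \<Rightarrow> real"
  assumes cont: "continuous_on UNIV f" and per: "\<And>x. f (x + T) = f x" and u: "0 \<le> u" "u \<le> T"
  shows "integral {0..T} (\<lambda>x. f (x + u)) = integral {0..T} f"
proof -
  have int: "f integrable_on {a..b}" for a b
    by (intro integrable_continuous_real continuous_on_subset[OF cont]) auto
  have shift: "integral {a..b} (\<lambda>x. f (x + c)) = integral {a + c..b + c} f" for a b c
    using integral_shift_Icc_real[of a b f c] by (simp add: o_def add.commute)
  have "integral {0..T} (\<lambda>x. f (x + u)) = integral {u..T + u} f"
    by (simp add: shift)
  also have "\<dots> = integral {u..T} f + integral {T..T + u} f"
    using u int by (intro Henstock_Kurzweil_Integration.integral_combine[symmetric]) auto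
  also have "integral {T..T + u} f = integral {0..u} (\<lambda>x. f (x + T))"
    by (simp add: shift add.commute)
  also have "\<dots> = integral {0..u} f" by (simp add: per)
  also have "integral {u..T} f + integral {0..u} f = integral {0..T} f"
    using u int Henstock_Kurzweil_Integration.integral_combine[of 0 u T f] by simp
  finally show ?thesis .
qed

lemma integral_even_period:
  fixes f :: "real \<Rightarrow> real"
  assumes cont: "continuous_on UNIV f" and per: "\<And>x. f (x + 2 * pi) = f x" and even: "\<And>x. f (- x) = f x"
  shows "integral {0..2 * pi} f = 2 * integral {0..pi} f"
proof -
  have int: "f integrable_on {a..b}" for a b
    by (intro integrable_continuous_real continuous_on_subset[OF cont]) auto
  have reflect: "f (2 * pi - x) = f x" for x
    using per[of "- x"] even[of x] by (simp add: algebra_simps)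
  have "integral {0..2 * pi} f = integral {0..pi} f + integral {pi..2 * pi} f"
    using int by (intro Henstock_Kurzweil_Integration.integral_combine[symmetric]) auto
  also have "integral {pi..2 * pi} f = integral {0..pi} f"
  proof -
    have "(f has_integral integral {pi..2*pi} f) (cbox pi (2 * pi))"
      using int by (auto simp: has_integral_integral)
    from has_integral_affinity[OF this, of "-1" "2 * pi"]
    have "((\<lambda>x. f (2 * pi - x)) has_integral integral {pi..2*pi} f) ((\<lambda>x. 2 * pi - x) ` {pi..2 * pi})"
      by simp
    also have "(\<lambda>x. 2 * pi - x) ` {pi..2 * pi} = {0..pi}"
      by (simp add: image_diff_atLeastAtMost)
    finally show ?thesis
      by (simp add: reflect integral_unique)
  qed
  finally show ?thesis by simp
qed

text \<open>Writing \<open>g'\<close> as a combination of translates of \<open>g\<close>, each of which has the same \<open>L\<^sup>1\<close> norm over a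
  period, bounds \<open>g'\<close> by the absolute sum of the coefficients. Both \<open>\<bar>g\<bar>\<close> and \<open>\<bar>g'\<bar>\<close> are even, which
  reduces the period to \<open>[0, \<pi>]\<close>.\<close>

lemma bernstein_L1:
  fixes b :: "nat \<Rightarrow> real"
  assumes n: "n \<ge> 1"
  defines "g \<equiv> \<lambda>x. \<Sum>k=1..n. b k * cos (real k * x)"
  defines "g' \<equiv> \<lambda>x. \<Sum>k=1..n. b k * (- real k * sin (real k * x))"
  shows "integral {0..pi} (\<lambda>x. \<bar>g' x\<bar>) \<le> 2 * real n * integral {0..pi} (\<lambda>x. \<bar>g x\<bar>)"
proof -
  obtain M :: nat and u lam :: "nat \<Rightarrow> real" where
    u: "\<forall>r<M. 0 \<le> u r \<and> u r \<le> 2 * pi" and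
    lam: "(\<Sum>r<M. \<bar>lam r\<bar>) \<le> 2 * real n" and
    CS: "\<forall>k\<in>{1..n}. (\<Sum>r<M. lam r * cos (real k * u r)) = 0 \<and>
      (\<Sum>r<M. lam r * sin (real k * u r)) = real k"
    using finite_difference_kernel[OF n] by blast
  have cg: "continuous_on A g" and cg': "continuous_on A g'" and cgs: "continuous_on A (\<lambda>x. g (x + c))" for A c
    unfolding g_def g'_def by (intro continuous_intros)+
  have per: "cos (real k * (x + 2 * pi)) = cos (real k * x)" "sin (real k * (x + 2 * pi)) = sin (real k * x)" for k x
  proof -
    have "real k * (x + 2 * pi) = real k * x + 2 * real k * pi" by (simp add: algebra_simps)
    then show "cos (real k * (x + 2 * pi)) = cos (real k * x)" "sin (real k * (x + 2 * pi)) = sin (real k * x)"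
      by (simp_all only: cos_add sin_add cos_2npi sin_2npi mult_1_right mult_zero_right add_0_right diff_0_right)
  qed
  have gper: "g (x + 2 * pi) = g x" "g' (x + 2 * pi) = g' x" for x
    by (simp_all only: g_def g'_def per)
  have geven: "g (- x) = g x" "g' (- x) = - g' x" for x
    by (simp_all add: g_def g'_def sum_negf)
  have diff: "g' x = (\<Sum>r<M. lam r * g (x + u r))" for x
  proof -
    have "(\<Sum>r<M. lam r * g (x + u r)) = (\<Sum>k=1..n. \<Sum>r<M. lam r * (b k * cos (real k * (x + u r))))"
      unfolding g_def sum_distrib_left by (rule sum.swap)
    also have "\<dots> = (\<Sum>k=1..n. b k * cos (real k * x) * (\<Sum>r<M. lam r * cos (real k * u r)) -
        b k * sin (real k * x) * (\<Sum>r<M. lam r * sin (real k * u r)))"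
      unfolding sum_distrib_left sum_subtractf[symmetric] distrib_left cos_add
      by (intro sum.cong refl) algebra
    also have "\<dots> = g' x" unfolding g'_def using CS by (intro sum.cong refl) simp
    finally show ?thesis by simp
  qed
  have "2 * integral {0..pi} (\<lambda>x. \<bar>g' x\<bar>) = integral {0..2 * pi} (\<lambda>x. \<bar>g' x\<bar>)"
    by (rule integral_even_period[symmetric]) (auto intro!: continuous_intros cg' simp: gper geven)
  also have "\<dots> \<le> integral {0..2 * pi} (\<lambda>x. \<Sum>r<M. \<bar>lam r\<bar> * \<bar>g (x + u r)\<bar>)"
  proof (rule integral_le)
    show "(\<lambda>x. \<bar>g' x\<bar>) integrable_on {0..2 * pi}"
      by (intro integrable_continuous_real continuous_intros cg')
    show "(\<lambda>x. \<Sum>r<M. \<bar>lam r\<bar> * \<bar>g (x + u r)\<bar>) integrable_on {0..2 * pi}"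
      by (intro integrable_continuous_real continuous_intros cgs)
    show "\<bar>g' x\<bar> \<le> (\<Sum>r<M. \<bar>lam r\<bar> * \<bar>g (x + u r)\<bar>)" for x
      unfolding diff by (rule order.trans[OF sum_abs]) (simp add: abs_mult)
  qed
  also have "\<dots> = (\<Sum>r<M. \<bar>lam r\<bar> * integral {0..2 * pi} (\<lambda>x. \<bar>g (x + u r)\<bar>))"
    by (subst integral_sum)
      (auto intro!: integrable_continuous_real continuous_intros cgs)
  also have "\<dots> = (\<Sum>r<M. \<bar>lam r\<bar> * integral {0..2 * pi} (\<lambda>x. \<bar>g x\<bar>))"
    using u by (intro sum.cong refl arg_cong2[where f="(*)"]
        integral_period_shift[where f = "\<lambda>x. \<bar>g x\<bar>"]) (auto intro!: continuous_intros cg simp: gper)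
  also have "\<dots> = (\<Sum>r<M. \<bar>lam r\<bar>) * (2 * integral {0..pi} (\<lambda>x. \<bar>g x\<bar>))"
    by (subst integral_even_period) (auto intro!: continuous_intros cg simp: gper geven sum_distrib_right)
  also have "\<dots> \<le> 2 * real n * (2 * integral {0..pi} (\<lambda>x. \<bar>g x\<bar>))"
    by (intro mult_right_mono lam mult_nonneg_nonneg integral_nonneg
        integrable_continuous_real continuous_intros cg) auto
  finally show ?thesis by simp
qed

section \<open>Equal-weight quadrature for sine polynomials\<close>

text \<open>The first-order condition on a compact interval: a minimum point with nonzero derivative is the end
  point towards which the function descends.\<close>

lemma derivative_at_interval_minimum:
  fixes f :: "real \<Rightarrow> real"
  assumes D: "(f has_real_derivative D) (at y)"
    and y: "\<bar>y - c\<bar> \<le> d" and min: "\<And>s. \<bar>s - c\<bar> \<le> d \<Longrightarrow> f y \<le> f s"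
  shows "D * (y - c) = - d * \<bar>D\<bar>"
proof (cases D "0 :: real" rule: linorder_cases)
  case equal
  then show ?thesis by simp
next
  case greater
  have "y = c - d"
  proof (rule ccontr)
    assume "y \<noteq> c - d"
    then have gap: "y - (c - d) > 0" using y by linarith
    obtain e where e: "e > 0" "\<And>h. 0 < h \<Longrightarrow> h < e \<Longrightarrow> f (y - h) < f y"
      using DERIV_pos_inc_left[OF D greater] by blast
    define h where "h = min (e / 2) (y - (c - d))"
    have "0 < h" "h < e" "h \<le> y - (c - d)" using e(1) gap by (auto simp: h_def)
    moreover from this have "\<bar>y - h - c\<bar> \<le> d" using y by linarith
    ultimately show False using e(2)[of h] min[of "y - h"] by force
  qed
  then show ?thesis using greater by simp
next
  case less
  have "y = c + d"
  proof (rule ccontr)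
    assume "y \<noteq> c + d"
    then have gap: "c + d - y > 0" using y by linarith
    obtain e where e: "e > 0" "\<And>h. 0 < h \<Longrightarrow> h < e \<Longrightarrow> f (y + h) < f y"
      using DERIV_neg_dec_right[OF D less] by blast
    define h where "h = min (e / 2) (c + d - y)"
    have "0 < h" "h < e" "h \<le> c + d - y" using e(1) gap by (auto simp: h_def)
    moreover from this have "\<bar>y + h - c\<bar> \<le> d" using y by linarith
    ultimately show False using e(2)[of h] min[of "y + h"] by force
  qed
  then show ?thesis using less by simp
qed

text \<open>Here \<open>I\<close> is a cell of length \<open>h\<close> and \<open>y\<close> a point that satisfies the first-order condition on its middle
  half. On the cell \<open>P'\<close> oscillates by at most the integral of \<open>\<bar>P''\<bar>\<close>, so up to errors of that size \<open>P\<close> is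
  affine: the midpoint rule is exact, and moving from the midpoint to \<open>y\<close> lowers \<open>P\<close> by \<open>h / 4\<close> times
  the mean of \<open>\<bar>P'\<bar>\<close>.\<close>

lemma descending_node_estimate:
  fixes P P' P'' :: "real \<Rightarrow> real"
  assumes P: "\<And>x. (P has_real_derivative P' x) (at x)"
    and P': "\<And>x. (P' has_real_derivative P'' x) (at x)" and cont: "continuous_on UNIV P''"
    and h: "h > 0" and y: "\<bar>y - c\<bar> \<le> h / 4" "P' y * (y - c) = - (h / 4) * \<bar>P' y\<bar>"
  defines "I \<equiv> {c - h / 2..c + h / 2}"
  shows "h * P y - integral I P \<le> h\<^sup>2 * integral I (\<lambda>x. \<bar>P'' x\<bar>) - h / 4 * integral I (\<lambda>x. \<bar>P' x\<bar>)"
proof -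
  define A where "A = integral I (\<lambda>x. \<bar>P' x\<bar>)"
  define B where "B = integral I (\<lambda>x. \<bar>P'' x\<bar>)"
  have cP: "continuous_on X P" and cP': "continuous_on X P'" and cP'': "continuous_on X P''" for X
    using DERIV_continuous_on[of X P P'] DERIV_continuous_on[of X P' P''] P P'
      continuous_on_subset[OF cont] by (auto intro: has_field_derivative_at_within)
  note ints = integrable_continuous_real cP cP' cP'' continuous_intros
  have osc0: "P' x - P' s \<le> B \<and> P' s - P' x \<le> B" if "x \<in> I" "s \<in> I" "s \<le> x" for x s
  proof -
    have "(P'' has_integral P' x - P' s) {s..x}"
      using that P' by (intro fundamental_theorem_of_calculus)
        (auto simp: has_real_derivative_iff_has_vector_derivative[symmetric] intro: has_field_derivative_at_within)
    then have "P' x - P' s = integral {s..x} P''" by (simp add: integral_unique)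
    also have "\<bar>\<dots>\<bar> \<le> integral {s..x} (\<lambda>x. \<bar>P'' x\<bar>)"
      using integral_norm_bound_integral[of P'' "{s..x}" "\<lambda>x. \<bar>P'' x\<bar>"] by (simp add: ints)
    also have "\<dots> \<le> B"
      unfolding B_def using that by (intro integral_subset_le) (auto simp: I_def intro!: ints)
    finally show ?thesis by linarith
  qed
  have osc: "\<bar>P' x - P' s\<bar> \<le> B" if "x \<in> I" "s \<in> I" for x s
    using osc0[of x s] osc0[of s x] that by (cases "s \<le> x") auto
  have taylor: "\<bar>P x - P c - P' s * (x - c)\<bar> \<le> B * \<bar>x - c\<bar>" if x: "x \<in> I" and s: "s \<in> I" for x s
  proof -
    have "\<exists>z\<in>I. P x - P c = P' z * (x - c)"
    proof (cases x c rule: linorder_cases)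
      case less
      from MVT2[OF this, of P P'] P obtain z where "x < z" "z < c" "P c - P x = (c - x) * P' z" by blast
      then show ?thesis using x h by (intro bexI[of _ z]) (auto simp: I_def algebra_simps)
    next
      case greater
      from MVT2[OF this, of P P'] P obtain z where "c < z" "z < x" "P x - P c = (x - c) * P' z" by blast
      then show ?thesis using x h by (intro bexI[of _ z]) (auto simp: I_def algebra_simps)
    qed (use x in auto)
    then obtain z where z: "z \<in> I" "P x - P c = P' z * (x - c)" by blast
    then have "\<bar>P x - P c - P' s * (x - c)\<bar> = \<bar>P' z - P' s\<bar> * \<bar>x - c\<bar>"
      by (simp add: left_diff_distrib flip: abs_mult)
    also have "\<dots> \<le> B * \<bar>x - c\<bar>" using osc[OF z(1) s] by (intro mult_right_mono) auto
    finally show ?thesis .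
  qed
  have "c - h / 2 \<le> y" "y \<le> c + h / 2" using h y(1) by linarith+
  then have cI: "c \<in> I" and yI: "y \<in> I" using h by (auto simp: I_def)
  have B0: "B \<ge> 0" unfolding B_def I_def by (intro integral_nonneg ints) auto
  \<comment> \<open>The linear Taylor term integrates to zero by symmetry about the midpoint.\<close>
  have mid: "h * P c - integral I P \<le> h\<^sup>2 / 2 * B"
  proof -
    have "h * P c - h\<^sup>2 / 2 * B = integral I (\<lambda>x. P c + P' c * (x - c) - h / 2 * B)"
    proof -
      have "((\<lambda>x. P c + P' c * (x - c) - h / 2 * B) has_integral
          (\<lambda>x. P c * x + P' c * ((x - c)\<^sup>2 / 2) - h / 2 * B * x) (c + h / 2) -
          (\<lambda>x. P c * x + P' c * ((x - c)\<^sup>2 / 2) - h / 2 * B * x) (c - h / 2)) I"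
        unfolding I_def using h
        by (intro fundamental_theorem_of_calculus)
          (auto simp: has_real_derivative_iff_has_vector_derivative[symmetric] field_simps
            intro!: derivative_eq_intros)
      from integral_unique[OF this] show ?thesis
        by (simp add: power2_eq_square field_simps)
    qed
    also have "\<dots> \<le> integral I P"
    proof (rule integral_le)
      fix x assume x: "x \<in> I"
      then have "\<bar>x - c\<bar> \<le> h / 2" unfolding I_def atLeastAtMost_iff by linarith
      then have "B * \<bar>x - c\<bar> \<le> B * (h / 2)" using B0 by (intro mult_left_mono)
      then show "P c + P' c * (x - c) - h / 2 * B \<le> P x" using taylor[OF x cI] by (simp add: mult.commute)
    qed (auto simp: I_def intro!: ints)
    finally show ?thesis by simp
  qed
  have "P y - P c \<le> P' y * (y - c) + B * \<bar>y - c\<bar>" using taylor[OF yI yI] by linarith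
  also have "\<dots> \<le> - (h / 4) * \<bar>P' y\<bar> + B * (h / 4)"
    using y B0 by (intro add_mono mult_left_mono) auto
  finally have desc: "P y - P c \<le> - (h / 4) * \<bar>P' y\<bar> + B * (h / 4)" .
  have "A \<le> integral I (\<lambda>x. \<bar>P' y\<bar> + B)"
    unfolding A_def
  proof (rule integral_le)
    show "\<bar>P' x\<bar> \<le> \<bar>P' y\<bar> + B" if "x \<in> I" for x using osc[OF that yI] by linarith
  qed (auto simp: I_def intro!: ints)
  also have "\<dots> = h * (\<bar>P' y\<bar> + B)" using h by (simp add: I_def)
  finally have gain: "A \<le> h * (\<bar>P' y\<bar> + B)" .
  have "h * (P y - P c) \<le> h * (- (h / 4) * \<bar>P' y\<bar> + B * (h / 4))"
    using desc h by (intro mult_left_mono) auto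
  moreover have "h / 4 * A \<le> h / 4 * (h * (\<bar>P' y\<bar> + B))" using gain h by (intro mult_left_mono) auto
  ultimately have "h * P y - integral I P \<le> h\<^sup>2 * B - h / 4 * A"
    using mid by (simp add: power2_eq_square algebra_simps)
  then show ?thesis unfolding A_def B_def .
qed

lemma integral_equal_cells:
  fixes f :: "real \<Rightarrow> real"
  assumes cont: "continuous_on UNIV f" and h: "h \<ge> 0"
  shows "integral {0..real N * h} f = (\<Sum>j<N. integral {real j * h..real (Suc j) * h} f)"
proof (induction N)
  case (Suc N)
  have "integral {0..real (Suc N) * h} f =
      integral {0..real N * h} f + integral {real N * h..real (Suc N) * h} f"
    using h by (intro Henstock_Kurzweil_Integration.integral_combine[symmetric] integrable_continuous_real
        continuous_on_subset[OF cont]) (auto simp: algebra_simps)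
  then show ?case using Suc by simp
qed simp

lemma compact_box_of_sequences:
  fixes c :: "nat \<Rightarrow> real"
  shows "compact {y :: nat \<Rightarrow> real. \<forall>j. \<bar>y j - c j\<bar> \<le> d}"
proof -
  have "compactin (product_topology (\<lambda>_. euclidean) UNIV) (PiE UNIV (\<lambda>j. {c j - d..c j + d}))"
    by (simp add: compactin_PiE)
  then have "compact (PiE UNIV (\<lambda>j. {c j - d..c j + d}))"
    by (simp add: euclidean_product_topology)
  also have "PiE UNIV (\<lambda>j. {c j - d..c j + d}) = {y :: nat \<Rightarrow> real. \<forall>j. \<bar>y j - c j\<bar> \<le> d}"
    by (auto simp: PiE_UNIV_domain Pi_def abs_le_iff algebra_simps)
  finally show ?thesis .
qed

text \<open>The nodes minimize the sum \<open>\<Phi>\<close> of the squared quadrature errors \<open>R y k\<close>. With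
  \<open>P = (\<Sum>k. R y k sin (k x))\<close>, the value \<open>\<Phi> y\<close> is the quadrature error of \<open>P\<close> and the partial derivatives of
  \<open>\<Phi>\<close> are \<open>2 h P'(y j)\<close>. Hence the nodes satisfy the first-order condition in every cell, and summing
  the cell estimates gives a nonpositive value. The factor \<open>32\<close> comes from the requirement
  \<open>2 n h \<le> 1 / 4\<close> with \<open>h = \<pi> / N\<close> and \<open>\<pi> < 4\<close>.\<close>

lemma equal_weight_sine_quadrature:
  fixes n N :: nat
  assumes n: "n \<ge> 1" and N: "N \<ge> 32 * n"
  shows "\<exists>y :: nat \<Rightarrow> real.
    (\<forall>j. \<bar>y j - (real j + 1 / 2) * (pi / real N)\<bar> \<le> pi / real N / 4) \<and>
    (\<forall>k\<in>{1..n}. pi / real N * (\<Sum>j<N. sin (real k * y j)) = integral {0..pi} (\<lambda>x. sin (real k * x)))"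
proof -
  have N0: "real N > 0" using n N by simp
  define h where "h = pi / real N"
  have h0: "h > 0" using N0 by (simp add: h_def)
  define c where "c j = (real j + 1 / 2) * h" for j :: nat
  define K where "K = {y :: nat \<Rightarrow> real. \<forall>j. \<bar>y j - c j\<bar> \<le> h / 4}"
  define R where "R y k = h * (\<Sum>j<N. sin (real k * y j)) - integral {0..pi} (\<lambda>x. sin (real k * x))"
    for y :: "nat \<Rightarrow> real" and k :: nat
  define \<Phi> where "\<Phi> y = (\<Sum>k=1..n. (R y k)\<^sup>2)" for y
  have "compact K" unfolding K_def by (rule compact_box_of_sequences)
  moreover have "c \<in> K" using h0 by (simp add: K_def)
  moreover have "continuous_on K \<Phi>"
    unfolding \<Phi>_def R_def
    by (intro continuous_intros continuous_on_subset[OF continuous_on_product_coordinates]) auto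
  ultimately obtain y where y: "y \<in> K" and min: "\<And>z. z \<in> K \<Longrightarrow> \<Phi> y \<le> \<Phi> z"
    using continuous_attains_inf[of K \<Phi>] by blast
  define P where "P x = (\<Sum>k=1..n. R y k * sin (real k * x))" for x
  define P' where "P' x = (\<Sum>k=1..n. (real k * R y k) * cos (real k * x))" for x
  define P'' where "P'' x = (\<Sum>k=1..n. (real k * R y k) * (- real k * sin (real k * x)))" for x
  have dP: "(P has_real_derivative P' x) (at x)" for x
    unfolding P_def P'_def by (auto intro!: derivative_eq_intros sum.cong simp: mult_ac)
  have dP': "(P' has_real_derivative P'' x) (at x)" for x
    unfolding P'_def P''_def by (auto intro!: derivative_eq_intros sum.cong simp: mult_ac)
  have cP: "continuous_on A P" and cP': "continuous_on A P'" and cP'': "continuous_on A P''" for A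
    unfolding P_def P'_def P''_def by (intro continuous_intros)+
  have crit: "P' (y j) * (y j - c j) = - (h / 4) * \<bar>P' (y j)\<bar>" if j: "j < N" for j
  proof -
    have upd: "((\<lambda>s. sin (real k * (y(j := s)) i)) has_real_derivative
        (if i = j then real k * cos (real k * y j) else 0)) (at (y j))" for k i
      by (auto intro!: derivative_eq_intros)
    have "((\<lambda>s. R (y(j := s)) k) has_real_derivative h * (real k * cos (real k * y j))) (at (y j))" for k
    proof -
      have "((\<lambda>s. R (y(j := s)) k) has_real_derivative
          h * (\<Sum>i<N. if i = j then real k * cos (real k * y j) else 0) - 0) (at (y j))"
        unfolding R_def by (intro DERIV_diff DERIV_cmult DERIV_sum upd DERIV_const)
      then show ?thesis using j by simp
    qed
    note dR = this
    have "((\<lambda>s. \<Phi> (y(j := s))) has_real_derivative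
        (\<Sum>k=1..n. 2 * (h * (real k * cos (real k * y j))) * R y k)) (at (y j))"
      unfolding \<Phi>_def by (intro DERIV_sum) (auto intro!: derivative_eq_intros dR)
    also have "(\<Sum>k=1..n. 2 * (h * (real k * cos (real k * y j))) * R y k) = 2 * h * P' (y j)"
      unfolding P'_def sum_distrib_left by (intro sum.cong refl) simp
    finally have D: "((\<lambda>s. \<Phi> (y(j := s))) has_real_derivative 2 * h * P' (y j)) (at (y j))" .
    have "2 * h * P' (y j) * (y j - c j) = - (h / 4) * \<bar>2 * h * P' (y j)\<bar>"
    proof (rule derivative_at_interval_minimum[OF D])
      show "\<bar>y j - c j\<bar> \<le> h / 4" using y by (auto simp: K_def)
      fix s assume "\<bar>s - c j\<bar> \<le> h / 4"
      then have "y(j := s) \<in> K" using y by (auto simp: K_def)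
      then show "\<Phi> (y(j := y j)) \<le> \<Phi> (y(j := s))" using min by simp
    qed
    then have "2 * h * (P' (y j) * (y j - c j)) = 2 * h * (- (h / 4) * \<bar>P' (y j)\<bar>)"
      using h0 by (simp only: abs_mult abs_of_pos abs_numeral mult_ac)
    then show ?thesis using h0 by (subst (asm) mult_cancel_left) argo
  qed
  have intP: "integral {0..pi} P = (\<Sum>k=1..n. R y k * integral {0..pi} (\<lambda>x. sin (real k * x)))"
    unfolding P_def by (subst integral_sum) (auto intro!: integrable_continuous_real continuous_intros)
  have sumP: "(\<Sum>j<N. P (y j)) = (\<Sum>k=1..n. R y k * (\<Sum>j<N. sin (real k * y j)))"
    unfolding P_def by (subst sum.swap) (simp add: sum_distrib_left)
  have "\<Phi> y = h * (\<Sum>j<N. P (y j)) - integral {0..pi} P"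
    unfolding \<Phi>_def intP sumP sum_distrib_left[of h] sum_subtractf[symmetric]
    by (intro sum.cong refl) (simp add: power2_eq_square R_def algebra_simps)
  also have pi_eq: "pi = real N * h" using N0 by (simp add: h_def)
  also have "h * (\<Sum>j<N. P (y j)) - integral {0..real N * h} P =
      (\<Sum>j<N. h * P (y j) - integral {real j * h..real (Suc j) * h} P)"
    using h0 by (simp add: integral_equal_cells[OF cP] sum_distrib_left sum_subtractf)
  also have "\<dots> \<le> (\<Sum>j<N. h\<^sup>2 * integral {real j * h..real (Suc j) * h} (\<lambda>x. \<bar>P'' x\<bar>) -
      h / 4 * integral {real j * h..real (Suc j) * h} (\<lambda>x. \<bar>P' x\<bar>))"
  proof (rule sum_mono)
    fix j assume j: "j \<in> {..<N}"
    have I: "{real j * h..real (Suc j) * h} = {c j - h / 2..c j + h / 2}"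
      by (simp add: c_def algebra_simps)
    show "h * P (y j) - integral {real j * h..real (Suc j) * h} P \<le>
        h\<^sup>2 * integral {real j * h..real (Suc j) * h} (\<lambda>x. \<bar>P'' x\<bar>) -
        h / 4 * integral {real j * h..real (Suc j) * h} (\<lambda>x. \<bar>P' x\<bar>)"
      unfolding I using y j by (intro descending_node_estimate dP dP' cP'' h0 crit) (auto simp: K_def)
  qed
  also have "\<dots> = h\<^sup>2 * integral {0..real N * h} (\<lambda>x. \<bar>P'' x\<bar>) - h / 4 * integral {0..real N * h} (\<lambda>x. \<bar>P' x\<bar>)"
    using h0 by (subst (1 2) integral_equal_cells)
      (auto intro!: continuous_intros cP' cP'' simp: sum_distrib_left sum_subtractf)
  also have "\<dots> = h * (h * integral {0..pi} (\<lambda>x. \<bar>P'' x\<bar>) - 1 / 4 * integral {0..pi} (\<lambda>x. \<bar>P' x\<bar>))"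
    unfolding pi_eq[symmetric] by (simp add: power2_eq_square right_diff_distrib)
  also have "\<dots> \<le> 0"
  proof -
    have "integral {0..pi} (\<lambda>x. \<bar>P'' x\<bar>) \<le> 2 * real n * integral {0..pi} (\<lambda>x. \<bar>P' x\<bar>)"
      unfolding P'_def P''_def by (rule bernstein_L1[OF n])
    then have "h * integral {0..pi} (\<lambda>x. \<bar>P'' x\<bar>) \<le> h * (2 * real n) * integral {0..pi} (\<lambda>x. \<bar>P' x\<bar>)"
      using h0 by (simp add: mult.assoc)
    also have "\<dots> \<le> 1 / 4 * integral {0..pi} (\<lambda>x. \<bar>P' x\<bar>)"
    proof (rule mult_right_mono)
      have "pi * (8 * real n) \<le> 4 * (8 * real n)"
        using pi_less_4 by (intro mult_right_mono) auto
      also have "\<dots> \<le> real N" using N by linarith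
      finally show "h * (2 * real n) \<le> 1 / 4" using N0 by (simp add: h_def field_simps)
      show "0 \<le> integral {0..pi} (\<lambda>x. \<bar>P' x\<bar>)"
        by (intro integral_nonneg integrable_continuous_real continuous_intros cP') auto
    qed
    finally show ?thesis using h0 by (simp add: mult_le_0_iff)
  qed
  finally have "\<Phi> y \<le> 0" .
  then have "\<Phi> y = 0" unfolding \<Phi>_def by (intro antisym sum_nonneg) auto
  then have "R y k = 0" if "k \<in> {1..n}" for k
    using that unfolding \<Phi>_def by (subst (asm) sum_nonneg_eq_0_iff) auto
  then show ?thesis
    using y by (intro exI[of _ y]) (auto simp: K_def R_def h_def c_def)
qed

text \<open>The function \<open>sin\<^sup>2\<^sup>m\<^sup>+\<^sup>1 cos\<^sup>c\<close> is a combination of \<open>sin (k x)\<close> with \<open>1 \<le> k \<le> 2 m + 1 + c\<close>. Instead of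
  the coefficients, the proof propagates the vanishing of the quadrature error: a factor \<open>cos x\<close> moves the
  frequency by one, and two factors \<open>sin x\<close> are traded for two factors \<open>cos x\<close>.\<close>

lemma quadrature_sin_cos_powers:
  fixes y :: "nat \<Rightarrow> real"
  assumes Q: "\<And>k. k \<in> {1..n} \<Longrightarrow> h * (\<Sum>j<N. sin (real k * y j)) = integral {0..pi} (\<lambda>x. sin (real k * x))"
    and "2 * m + 1 + c \<le> n"
  shows "h * (\<Sum>j<N. sin (y j) ^ (2 * m + 1) * cos (y j) ^ c) =
    integral {0..pi} (\<lambda>x. sin x ^ (2 * m + 1) * cos x ^ c)"
proof -
  define E where "E f = h * (\<Sum>j<N. f (y j)) - integral {0..pi} f" for f :: "real \<Rightarrow> real"
  have lin: "E (\<lambda>x. a * f x + b * g x) = a * E f + b * E g"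
    if "continuous_on {0..pi} f" "continuous_on {0..pi} g" for a b f g
  proof -
    have "integral {0..pi} (\<lambda>x. a * f x + b * g x) = a * integral {0..pi} f + b * integral {0..pi} g"
      using that by (subst Henstock_Kurzweil_Integration.integral_add)
        (auto intro!: integrable_continuous_real continuous_intros)
    then show ?thesis
      by (simp add: E_def sum.distrib algebra_simps flip: sum_distrib_left)
  qed
  have base: "E (\<lambda>x. sin (real k * x) * cos x ^ c) = 0" if "k + c \<le> n" for k c
    using that
  proof (induction c arbitrary: k)
    case 0
    then show ?case using Q[of k] by (cases "k = 0") (auto simp: E_def)
  next
    case (Suc c)
    show ?case
    proof (cases k)
      case 0
      then show ?thesis by (simp add: E_def)
    next
      case (Suc l)
      have "(\<lambda>x. sin (real k * x) * cos x ^ Suc c) =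
          (\<lambda>x. 1 / 2 * (sin (real (Suc k) * x) * cos x ^ c) + 1 / 2 * (sin (real l * x) * cos x ^ c))"
      proof
        fix x
        have "sin (real k * x) * cos x = 1 / 2 * (sin (real k * x + x) + sin (real k * x - x))"
          by (simp add: sin_add sin_diff)
        also have "real k * x + x = real (Suc k) * x" by (simp add: algebra_simps)
        also have "real k * x - x = real l * x" by (simp add: Suc algebra_simps)
        finally have "sin (real k * x) * cos x * cos x ^ c =
            1 / 2 * (sin (real (Suc k) * x) + sin (real l * x)) * cos x ^ c" by simp
        then show "sin (real k * x) * cos x ^ Suc c =
            1 / 2 * (sin (real (Suc k) * x) * cos x ^ c) + 1 / 2 * (sin (real l * x) * cos x ^ c)"
          by (simp only: power_Suc mult.assoc distrib_left distrib_right)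
      qed
      then have "E (\<lambda>x. sin (real k * x) * cos x ^ Suc c) =
          1 / 2 * E (\<lambda>x. sin (real (Suc k) * x) * cos x ^ c) + 1 / 2 * E (\<lambda>x. sin (real l * x) * cos x ^ c)"
        by (simp only:) (rule lin; intro continuous_intros)
      then show ?thesis using Suc.IH[of "Suc k"] Suc.IH[of l] Suc.prems \<open>k = Suc l\<close> by simp
    qed
  qed
  have "E (\<lambda>x. sin x ^ (2 * m + 1) * cos x ^ c) = 0" using assms(2)
  proof (induction m arbitrary: c)
    case 0
    then show ?case using base[of 1 c] by simp
  next
    case (Suc m)
    have "(\<lambda>x :: real. sin x ^ (2 * Suc m + 1) * cos x ^ c) =
        (\<lambda>x. 1 * (sin x ^ (2 * m + 1) * cos x ^ c) + (- 1) * (sin x ^ (2 * m + 1) * cos x ^ (c + 2)))"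
    proof
      fix x :: real
      have "sin x ^ (2 * Suc m + 1) * cos x ^ c = (sin x)\<^sup>2 * (sin x ^ (2 * m + 1) * cos x ^ c)"
        by (simp add: power2_eq_square mult_ac)
      also have "\<dots> = (1 - (cos x)\<^sup>2) * (sin x ^ (2 * m + 1) * cos x ^ c)" by (simp add: sin_squared_eq)
      finally show "sin x ^ (2 * Suc m + 1) * cos x ^ c =
          1 * (sin x ^ (2 * m + 1) * cos x ^ c) + (- 1) * (sin x ^ (2 * m + 1) * cos x ^ (c + 2))"
        by (simp add: power_add power2_eq_square algebra_simps)
    qed
    then have "E (\<lambda>x. sin x ^ (2 * Suc m + 1) * cos x ^ c) =
        1 * E (\<lambda>x. sin x ^ (2 * m + 1) * cos x ^ c) + (- 1) * E (\<lambda>x. sin x ^ (2 * m + 1) * cos x ^ (c + 2))"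
      by (simp only:) (rule lin; intro continuous_intros)
    then show ?case using Suc.IH[of c] Suc.IH[of "c + 2"] Suc.prems by simp
  qed
  then show ?thesis by (simp add: E_def)
qed


section \<open>Moments of the sphere\<close>

text \<open>Integration of the derivative of \<open>cos\<^sup>a\<^sup>+\<^sup>1 sin\<^sup>b\<^sup>+\<^sup>1\<close>, whose boundary values cancel, together with
  \<open>cos\<^sup>2 + sin\<^sup>2 = 1\<close>.\<close>

lemma trig_power_recurrences:
  fixes u v :: real and a b :: nat
  defines "J \<equiv> \<lambda>a b. integral {u..v} (\<lambda>x. cos x ^ a * sin x ^ b)"
  assumes uv: "u \<le> v" and bd: "cos v ^ Suc a * sin v ^ Suc b = cos u ^ Suc a * sin u ^ Suc b"
  shows "real (a + b + 2) * J (a + 2) b = real (a + 1) * J a b"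
    and "real (a + b + 2) * J a (b + 2) = real (b + 1) * J a b"
proof -
  have int: "(\<lambda>x :: real. cos x ^ a * sin x ^ b) integrable_on {u..v}" for a b
    by (intro integrable_continuous_real continuous_intros)
  have "((\<lambda>x. real (b + 1) * (cos x ^ (a + 2) * sin x ^ b) - real (a + 1) * (cos x ^ a * sin x ^ (b + 2)))
      has_integral cos v ^ Suc a * sin v ^ Suc b - cos u ^ Suc a * sin u ^ Suc b) {u..v}"
    using uv
  proof (intro fundamental_theorem_of_calculus)
    fix x
    have "((\<lambda>x. cos x ^ Suc a * sin x ^ Suc b) has_real_derivative
        (1 + of_nat a) * (- sin x * cos x ^ a) * sin x ^ Suc b +
        (1 + of_nat b) * (cos x * sin x ^ b) * cos x ^ Suc a) (at x within {u..v})"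
      by (intro DERIV_mult DERIV_power_Suc has_field_derivative_at_within[OF DERIV_cos]
          has_field_derivative_at_within[OF DERIV_sin])
    then show "((\<lambda>x. cos x ^ Suc a * sin x ^ Suc b) has_vector_derivative
        real (b + 1) * (cos x ^ (a + 2) * sin x ^ b) - real (a + 1) * (cos x ^ a * sin x ^ (b + 2)))
        (at x within {u..v})"
      unfolding has_real_derivative_iff_has_vector_derivative
      by (rule has_vector_derivative_eq_rhs) (simp add: algebra_simps)
  qed
  then have "integral {u..v} (\<lambda>x. real (b + 1) * (cos x ^ (a + 2) * sin x ^ b) -
      real (a + 1) * (cos x ^ a * sin x ^ (b + 2))) = 0"
    unfolding bd by (simp add: integral_unique)
  then have 1: "real (b + 1) * J (a + 2) b = real (a + 1) * J a (b + 2)"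
    unfolding J_def
    by (subst (asm) Henstock_Kurzweil_Integration.integral_diff)
      (auto intro!: integrable_continuous_real continuous_intros simp del: of_nat_add)
  have "J (a + 2) b + J a (b + 2) = integral {u..v} (\<lambda>x. cos x ^ (a + 2) * sin x ^ b + cos x ^ a * sin x ^ (b + 2))"
    unfolding J_def by (rule Henstock_Kurzweil_Integration.integral_add[symmetric, OF int int])
  also have "(\<lambda>x :: real. cos x ^ (a + 2) * sin x ^ b + cos x ^ a * sin x ^ (b + 2)) =
      (\<lambda>x. ((cos x)\<^sup>2 + (sin x)\<^sup>2) * (cos x ^ a * sin x ^ b))"
    unfolding power_add distrib_right by (simp only: mult_ac)
  also have "integral {u..v} \<dots> = J a b" by (simp add: J_def del: sin_cos_squared_add3)
  finally have 2: "J (a + 2) b + J a (b + 2) = J a b" .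
  show "real (a + b + 2) * J (a + 2) b = real (a + 1) * J a b"
    and "real (a + b + 2) * J a (b + 2) = real (b + 1) * J a b"
    unfolding 2[symmetric] using 1 by (simp_all add: algebra_simps)
qed

definition azimuth_moment :: "nat \<Rightarrow> nat \<Rightarrow> real" where
  "azimuth_moment a b = integral {0..2 * pi} (\<lambda>\<phi>. cos \<phi> ^ a * sin \<phi> ^ b)"

definition polar_moment :: "nat \<Rightarrow> nat \<Rightarrow> real" where
  "polar_moment p c = integral {0..pi} (\<lambda>\<theta>. cos \<theta> ^ c * sin \<theta> ^ p)"

text \<open>This is \<open>4 \<pi>\<close> times the mean of the monomial with exponents \<open>a\<close>, \<open>b\<close>, \<open>c\<close> over the sphere. The extra
  \<open>1\<close> in the exponent is the area element \<open>sin \<theta>\<close>.\<close>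

definition sphere_moment :: "nat \<Rightarrow> nat \<Rightarrow> nat \<Rightarrow> real" where
  "sphere_moment a b c = azimuth_moment a b * polar_moment (a + b + 1) c"

lemma azimuth_moment_rec:
  "real (a + b + 2) * azimuth_moment (a + 2) b = real (a + 1) * azimuth_moment a b"
  "real (a + b + 2) * azimuth_moment a (b + 2) = real (b + 1) * azimuth_moment a b"
  unfolding azimuth_moment_def by (rule trig_power_recurrences; simp)+

lemma polar_moment_rec:
  "real (p + c + 2) * polar_moment (p + 2) c = real (p + 1) * polar_moment p c"
  "real (p + c + 2) * polar_moment p (c + 2) = real (c + 1) * polar_moment p c"
  unfolding polar_moment_def using trig_power_recurrences[of 0 pi c p] by (simp_all add: add_ac)

lemma integral_trig_power_one:
  fixes u v :: real
  assumes "u \<le> v"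
  shows "sin v = sin u \<Longrightarrow> integral {u..v} (\<lambda>x. cos x * sin x ^ b) = 0"
    and "cos v = cos u \<Longrightarrow> integral {u..v} (\<lambda>x. cos x ^ a * sin x) = 0"
proof -
  have ds: "((\<lambda>x. sin x ^ Suc b) has_real_derivative (1 + of_nat b) * (cos x * sin x ^ b)) (at x within A)"
    and dc: "((\<lambda>x. cos x ^ Suc a) has_real_derivative (1 + of_nat a) * (- sin x * cos x ^ a)) (at x within A)"
    for x A
    by (intro DERIV_power_Suc has_field_derivative_at_within[OF DERIV_sin]
        has_field_derivative_at_within[OF DERIV_cos])+
  have "((\<lambda>x. (1 + of_nat b) * (cos x * sin x ^ b)) has_integral sin v ^ Suc b - sin u ^ Suc b) {u..v}"
    using assms by (intro fundamental_theorem_of_calculus ds[unfolded has_real_derivative_iff_has_vector_derivative])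
  then have "integral {u..v} (\<lambda>x. (1 + of_nat b) * (cos x * sin x ^ b)) = sin v ^ Suc b - sin u ^ Suc b"
    by (rule integral_unique)
  moreover have "1 + real b \<noteq> 0" by linarith
  ultimately show "sin v = sin u \<Longrightarrow> integral {u..v} (\<lambda>x. cos x * sin x ^ b) = 0"
    by (simp only: integral_mult_right) simp
  have "((\<lambda>x. (1 + of_nat a) * (- sin x * cos x ^ a)) has_integral cos v ^ Suc a - cos u ^ Suc a) {u..v}"
    using assms by (intro fundamental_theorem_of_calculus dc[unfolded has_real_derivative_iff_has_vector_derivative])
  then have "integral {u..v} (\<lambda>x. (1 + of_nat a) * (- sin x * cos x ^ a)) = cos v ^ Suc a - cos u ^ Suc a"
    by (rule integral_unique)
  moreover have "1 + real a \<noteq> 0" by linarith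
  moreover have "(\<lambda>x. - sin x * cos x ^ a) = (\<lambda>x :: real. - (cos x ^ a * sin x))" by (simp add: mult.commute)
  ultimately show "cos v = cos u \<Longrightarrow> integral {u..v} (\<lambda>x. cos x ^ a * sin x) = 0"
    by (simp only: integral_mult_right) (simp add: mult.commute)
qed

lemma azimuth_moment_odd: "odd a \<or> odd b \<Longrightarrow> azimuth_moment a b = 0"
proof -
  have 1: "azimuth_moment (2 * m + 1) b = 0" for m
  proof (induction m)
    case 0
    then show ?case
      unfolding azimuth_moment_def using integral_trig_power_one(1)[of 0 "2 * pi" b] by simp
  next
    case (Suc m)
    then show ?case using azimuth_moment_rec(1)[of "2 * m + 1" b] by simp
  qed
  have 2: "azimuth_moment a (2 * m + 1) = 0" for m
  proof (induction m)
    case 0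
    then show ?case
      unfolding azimuth_moment_def using integral_trig_power_one(2)[of 0 "2 * pi" a] by simp
  next
    case (Suc m)
    then show ?case using azimuth_moment_rec(2)[of a "2 * m + 1"] by simp
  qed
  show "odd a \<or> odd b \<Longrightarrow> azimuth_moment a b = 0"
    using 1 2 by (metis oddE)
qed

lemma sphere_moment_rec:
  "real (a + b + c + 3) * sphere_moment (a + 2) b c = real (a + 1) * sphere_moment a b c"
  "real (a + b + c + 3) * sphere_moment a b (c + 2) = real (c + 1) * sphere_moment a b c"
proof -
  define W S where "W = azimuth_moment (a + 2) b" and "S = polar_moment (a + b + 1 + 2) c"
  have W: "real (a + b + 2) * W = real (a + 1) * azimuth_moment a b"
    unfolding W_def by (rule azimuth_moment_rec)
  have S: "real (a + b + c + 3) * S = real (a + b + 2) * polar_moment (a + b + 1) c"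
    using polar_moment_rec(1)[of "a + b + 1" c] by (simp add: S_def add_ac)
  have "real (a + b + c + 3) * (W * S) = (real (a + b + 2) * W) * polar_moment (a + b + 1) c"
    using arg_cong[OF S, of "\<lambda>x. W * x"] by (simp only: mult_ac)
  also have "\<dots> = real (a + 1) * sphere_moment a b c" unfolding W by (simp only: sphere_moment_def mult_ac)
  finally show "real (a + b + c + 3) * sphere_moment (a + 2) b c = real (a + 1) * sphere_moment a b c"
    by (simp add: sphere_moment_def W_def S_def add_ac)
  have "real (a + b + c + 3) * polar_moment (a + b + 1) (c + 2) = real (c + 1) * polar_moment (a + b + 1) c"
    using polar_moment_rec(2)[of "a + b + 1" c] by (simp add: add_ac)
  then show "real (a + b + c + 3) * sphere_moment a b (c + 2) = real (c + 1) * sphere_moment a b c"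
    unfolding sphere_moment_def by (metis mult.left_commute)
qed

text \<open>The spherical coordinates single out the third axis, so this symmetry is not visible in the definition. It
  holds because the recurrences in the first and in the third exponent have the same form.\<close>

lemma sphere_moment_swap: "sphere_moment a b c = sphere_moment c b a"
proof (induction "a + c" arbitrary: a c rule: less_induct)
  case less
  have step: "sphere_moment (d + 2) b e = sphere_moment e b (d + 2)"
    if eq: "sphere_moment d b e = sphere_moment e b d" for d e
  proof -
    have "real (d + b + e + 3) * sphere_moment (d + 2) b e = real (d + b + e + 3) * sphere_moment e b (d + 2)"
      using sphere_moment_rec(1)[of d b e] sphere_moment_rec(2)[of e b d] eq by (simp add: add_ac)
    moreover have "real (d + b + e + 3) \<noteq> 0" by linarith
    ultimately show ?thesis by (metis mult_left_cancel)
  qed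
  have zero: "sphere_moment 1 b 0 = sphere_moment 0 b 1"
  proof -
    have "polar_moment (b + 1) 1 = 0"
      unfolding polar_moment_def using integral_trig_power_one(1)[of 0 pi "b + 1"] by simp
    then show ?thesis by (simp add: sphere_moment_def azimuth_moment_odd)
  qed
  consider "a \<ge> 2" | "c \<ge> 2" | "a = c" | "a = 1" "c = 0" | "a = 0" "c = 1" by linarith
  then show ?case
  proof cases
    case 1
    then obtain d where "a = d + 2" by (metis le_add_diff_inverse2)
    then show ?thesis using step[OF less[of d c]] by simp
  next
    case 2
    then obtain d where "c = d + 2" by (metis le_add_diff_inverse2)
    then show ?thesis using step[OF less[of d a]] by simp
  qed (use zero in auto)
qed

lemma integral_normalized_surface_measure:
  fixes f :: "real^3 \<Rightarrow> real"
  assumes f: "continuous_on UNIV f"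
  shows "(LINT x|normalized_surface_measure. f x) =
    1 / (4 * pi) * integral {0..pi} (\<lambda>\<theta>. integral {0..2 * pi} (\<lambda>\<phi>. f (spherical_coords (\<theta>, \<phi>)) * sin \<theta>))"
proof -
  let ?R = "cbox (0::real, 0::real) (pi, 2 * pi)"
  have [measurable]: "f \<in> borel_measurable borel" using f by (rule borel_measurable_continuous_onI)
  have sets: "sets surface_measure = sets borel" by (simp add: surface_measure_def)
  have [measurable]: "(indicator (sphere 0 1) :: real^3 \<Rightarrow> real) \<in> borel_measurable borel"
    by (intro borel_measurable_indicator borel_closed) auto
  have eq: "indicator (sphere 0 1) x / emeasure surface_measure (sphere 0 1) =
      ennreal (indicator (sphere 0 1) x / (4 * pi))" for x :: "real^3"
    unfolding emeasure_surface_measure_sphere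
    by (auto simp: indicator_def divide_ennreal[symmetric])
  have ind: "indicator (sphere 0 1) (spherical_coords p) = (1 :: real)" for p
    using spherical_coords_in_sphere by (rule indicator_simps(1))
  have area0: "0 \<le> area_element p" for p
    by (cases p) (simp add: area_element_eq)
  have csc: "continuous_on A spherical_coords" for A
  proof -
    have eq: "spherical_coords = (\<lambda>p. (sin (fst p) * cos (snd p)) *\<^sub>R axis 1 1 +
        (sin (fst p) * sin (snd p)) *\<^sub>R axis 2 1 + cos (fst p) *\<^sub>R axis 3 1)"
      by (auto simp: spherical_coords_def vec_eq_iff forall_3 axis_def)
    show ?thesis unfolding eq by (intro continuous_intros)
  qed
  have cg: "continuous_on A (\<lambda>p. f (spherical_coords p) * sin (fst p))" for A
    by (intro continuous_intros continuous_on_compose2[OF f csc]) auto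
  have "(LINT x|normalized_surface_measure. f x) =
      (LINT x|surface_measure. (indicator (sphere 0 1) x / (4 * pi)) *\<^sub>R f x)"
    unfolding normalized_surface_measure_def uniform_measure_def eq
    by (rule integral_density) (auto simp: measurable_cong_sets[OF sets refl])
  also have "\<dots> = (LINT p|density (restrict_space lborel ?R) (\<lambda>p. ennreal (area_element p)).
      (indicator (sphere 0 1) (spherical_coords p) / (4 * pi)) *\<^sub>R f (spherical_coords p))"
    unfolding surface_measure_def
    by (rule integral_distr) (simp_all add: measurable_restrict_space1)
  also have "\<dots> = (LINT p|density (restrict_space lborel ?R) (\<lambda>p. ennreal (area_element p)).
      f (spherical_coords p) / (4 * pi))"
    by (simp only: ind) simp
  also have "\<dots> = (LINT p|restrict_space lborel ?R. area_element p *\<^sub>R (f (spherical_coords p) / (4 * pi)))"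
    by (rule integral_density) (simp_all add: measurable_restrict_space1 area0)
  also have "\<dots> = (LINT p:?R|lborel. area_element p *\<^sub>R (f (spherical_coords p) / (4 * pi)))"
    by (subst integral_restrict_space) (auto simp: set_lebesgue_integral_def)
  also have "\<dots> = (LINT p:?R|lborel. (f (spherical_coords p) * sin (fst p)) / (4 * pi))"
    by (rule set_lebesgue_integral_cong, simp) (auto simp: area_element_eq cbox_Pair_eq sin_ge_zero mult_ac)
  also have "\<dots> = integral ?R (\<lambda>p. (f (spherical_coords p) * sin (fst p)) / (4 * pi))"
    by (rule set_borel_integral_eq_integral(2), unfold set_integrable_def, rule borel_integrable_compact)
      (auto intro!: continuous_intros cg)
  also have "\<dots> = 1 / (4 * pi) * integral ?R (\<lambda>p. f (spherical_coords p) * sin (fst p))"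
    by (simp add: integral_divide)
  also have "integral ?R (\<lambda>p. f (spherical_coords p) * sin (fst p)) =
      integral {0..pi} (\<lambda>\<theta>. integral {0..2 * pi} (\<lambda>\<phi>. f (spherical_coords (\<theta>, \<phi>)) * sin \<theta>))"
    using integral_prod_continuous[OF cg] by simp
  finally show ?thesis .
qed

section \<open>Piecewise smooth curves and arc length integrals\<close>

lemma smooth_on_interval_subset:
  assumes "smooth_on_interval g a b" "a \<le> c" "d \<le> b"
  shows "smooth_on_interval g c d"
proof -
  from assms(1) obtain D where D: "D 0 = g"
    "\<And>k s. s \<in> {a..b} \<Longrightarrow> (D k has_vector_derivative D (Suc k) s) (at s within {a..b})"
    unfolding smooth_on_interval_def by blast
  show ?thesis
    unfolding smooth_on_interval_def using D assms(2,3)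
    by (intro exI[of _ D] conjI allI ballI has_vector_derivative_within_subset[OF D(2)]) auto
qed

lemma smooth_on_interval_cong:
  assumes "smooth_on_interval g a b" and eq: "\<And>s. s \<in> {a..b} \<Longrightarrow> g' s = g s"
  shows "smooth_on_interval g' a b"
proof -
  from assms(1) obtain D where D: "D 0 = g"
    "\<And>k s. s \<in> {a..b} \<Longrightarrow> (D k has_vector_derivative D (Suc k) s) (at s within {a..b})"
    unfolding smooth_on_interval_def by blast
  have "(D(0 := g')) k s = D k s" if "s \<in> {a..b}" for k s
    using eq[OF that] D(1) by simp
  then have "((D(0 := g')) k has_vector_derivative (D(0 := g')) (Suc k) s) (at s within {a..b})"
    if "s \<in> {a..b}" for k s
    using that has_vector_derivative_transform[OF that _ D(2)[OF that], of "(D(0 := g')) k" k] by simp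
  then show ?thesis
    unfolding smooth_on_interval_def by (intro exI[of _ "D(0 := g')"]) auto
qed

lemma smooth_on_interval_affine:
  assumes "smooth_on_interval g a b" and m: "m > 0"
  shows "smooth_on_interval (\<lambda>s. g (m * s + c)) ((a - c) / m) ((b - c) / m)"
proof -
  from assms(1) obtain D where D: "D 0 = g"
    "\<And>k s. s \<in> {a..b} \<Longrightarrow> (D k has_vector_derivative D (Suc k) s) (at s within {a..b})"
    unfolding smooth_on_interval_def by blast
  define J where "J = {(a - c) / m..(b - c) / m}"
  have img: "(\<lambda>s. m * s + c) ` J \<subseteq> {a..b}"
    using m by (auto simp: J_def field_simps)
  have "((\<lambda>s. m ^ k *\<^sub>R D k (m * s + c)) has_vector_derivative m ^ Suc k *\<^sub>R D (Suc k) (m * s + c)) (at s within J)"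
    if s: "s \<in> J" for k s
  proof -
    have "((\<lambda>s. m * s + c) has_vector_derivative m) (at s within J)"
      by (auto simp: has_real_derivative_iff_has_vector_derivative[symmetric] intro!: derivative_eq_intros)
    moreover have "(D k has_vector_derivative D (Suc k) (m * s + c)) (at (m * s + c) within (\<lambda>s. m * s + c) ` J)"
      using img s by (intro has_vector_derivative_within_subset[OF D(2)]) auto
    ultimately have "((D k \<circ> (\<lambda>s. m * s + c)) has_vector_derivative m *\<^sub>R D (Suc k) (m * s + c)) (at s within J)"
      by (rule vector_diff_chain_within)
    from bounded_linear.has_vector_derivative[OF bounded_linear_scaleR_right[of "m ^ k"] this]
    show ?thesis by (simp add: o_def mult.commute)
  qed
  then show ?thesis
    unfolding smooth_on_interval_def J_def[symmetric]
    by (intro exI[of _ "\<lambda>k s. m ^ k *\<^sub>R D k (m * s + c)"]) (auto simp: D(1))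
qed

text \<open>Piecewise smoothness on an arbitrary interval, by appending pieces on the right. Chains can be cut
  at any point and glued; a chain of no pieces covers a single point, so that cutting at a
  break point or at an end needs no special treatment.\<close>

inductive smooth_chain :: "(real \<Rightarrow> 'a::real_normed_vector) \<Rightarrow> real \<Rightarrow> real \<Rightarrow> bool" for g where
  chain_refl: "smooth_chain g a a"
| chain_step: "smooth_chain g a b \<Longrightarrow> b < c \<Longrightarrow> smooth_on_interval g b c \<Longrightarrow> smooth_chain g a c"

lemma smooth_chain_le: "smooth_chain g a b \<Longrightarrow> a \<le> b"
  by (induction rule: smooth_chain.induct) auto

lemma smooth_chain_trans: "smooth_chain g b c \<Longrightarrow> smooth_chain g a b \<Longrightarrow> smooth_chain g a c"
proof (induction rule: smooth_chain.induct)
  case (chain_step b c d)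
  show ?case by (rule smooth_chain.chain_step[OF chain_step.IH[OF chain_step.prems] chain_step.hyps(2,3)])
qed

lemma smooth_chain_cong:
  "smooth_chain g a b \<Longrightarrow> (\<And>s. s \<in> {a..b} \<Longrightarrow> g' s = g s) \<Longrightarrow> smooth_chain g' a b"
proof (induction rule: smooth_chain.induct)
  case (chain_step a b c)
  have "a \<le> b" using chain_step.hyps(1) by (rule smooth_chain_le)
  then have "smooth_chain g' a b" "smooth_on_interval g' b c"
    using chain_step by (auto intro: smooth_on_interval_cong)
  then show ?case by (rule smooth_chain.chain_step[OF _ chain_step.hyps(2)])
qed (rule chain_refl)

lemma smooth_chain_affine:
  "smooth_chain g a b \<Longrightarrow> m > 0 \<Longrightarrow> smooth_chain (\<lambda>s. g (m * s + c)) ((a - c) / m) ((b - c) / m)"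
proof (induction rule: smooth_chain.induct)
  case (chain_step a b d)
  then show ?case
    using smooth_on_interval_affine[OF chain_step.hyps(3) chain_step.prems, of c]
    by (intro smooth_chain.chain_step[OF chain_step.IH]) (simp_all add: divide_strict_right_mono)
qed (rule chain_refl)

lemma smooth_chain_split:
  "smooth_chain g a c \<Longrightarrow> a \<le> b \<Longrightarrow> b \<le> c \<Longrightarrow> smooth_chain g a b \<and> smooth_chain g b c"
proof (induction rule: smooth_chain.induct)
  case (chain_refl a)
  then have "b = a" by simp
  then show ?case by (simp add: smooth_chain.chain_refl)
next
  case (chain_step a d c)
  show ?case
  proof (cases "b \<le> d")
    case True
    then have "smooth_chain g a b" "smooth_chain g b d" using chain_step by auto
    then show ?thesis using chain_step.hyps smooth_chain.chain_step[of g b d c] by simp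
  next
    case False
    have "smooth_chain g a b"
      using False chain_step.prems
      by (intro smooth_chain.chain_step[OF chain_step.hyps(1)] smooth_on_interval_subset[OF chain_step.hyps(3)]) simp_all
    moreover have "smooth_chain g b c"
    proof (cases "b = c")
      case False
      then show ?thesis using \<open>\<not> b \<le> d\<close> chain_step.prems
        by (intro smooth_chain.chain_step[OF chain_refl] smooth_on_interval_subset[OF chain_step.hyps(3)]) simp_all
    qed (simp add: smooth_chain.chain_refl)
    ultimately show ?thesis ..
  qed
qed

lemma piecewise_smooth_iff_chain: "piecewise_smooth g \<longleftrightarrow> smooth_chain g 0 1"
proof
  assume "piecewise_smooth g"
  then obtain n p where p: "p 0 = 0" "p n = 1"
    "\<And>i. i < n \<Longrightarrow> p i < p (Suc i) \<and> smooth_on_interval g (p i) (p (Suc i))"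
    unfolding piecewise_smooth_def by blast
  have "k \<le> n \<Longrightarrow> smooth_chain g 0 (p k)" for k
  proof (induction k)
    case (Suc k)
    then show ?case using p(3)[of k] smooth_chain.chain_step[of g 0 "p k" "p (Suc k)"] by simp
  qed (simp add: p(1) smooth_chain.chain_refl)
  from this[of n] show "smooth_chain g 0 1" by (simp add: p(2))
next
  have "\<exists>(n::nat) p. p 0 = a \<and> p n = b \<and>
      (\<forall>i<n. p i < p (Suc i) \<and> smooth_on_interval g (p i) (p (Suc i)))" if "smooth_chain g a b" for a b
    using that
  proof (induction rule: smooth_chain.induct)
    case (chain_refl a)
    then show ?case by (intro exI[of _ 0] exI[of _ "\<lambda>_. a"]) simp
  next
    case (chain_step a b c)
    then obtain n :: nat and p where p: "p 0 = a" "p n = b"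
      "\<And>i. i < n \<Longrightarrow> p i < p (Suc i) \<and> smooth_on_interval g (p i) (p (Suc i))" by blast
    define q where "q = p(Suc n := c)"
    have "q i < q (Suc i) \<and> smooth_on_interval g (q i) (q (Suc i))" if "i < Suc n" for i
      using that p chain_step.hyps by (cases "i = n") (simp_all add: q_def)
    moreover have "q 0 = a" "q (Suc n) = c" by (simp_all add: q_def p(1))
    ultimately show ?case by blast
  qed
  then show "smooth_chain g 0 1 \<Longrightarrow> piecewise_smooth g"
    unfolding piecewise_smooth_def by blast
qed

text \<open>The arc length integral as a relation that carries its own derivative \<open>d\<close>, defined off a finite set. In this
  form it is stable under cutting, gluing and affine reparametrization.\<close>

definition has_arc_integral ::
  "(real \<Rightarrow> 'a::real_normed_vector) \<Rightarrow> ('a \<Rightarrow> real) \<Rightarrow> real \<Rightarrow> real \<Rightarrow> real \<Rightarrow> bool" where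
  "has_arc_integral g f a b I \<longleftrightarrow> (\<exists>S d. finite S \<and>
     (\<forall>s\<in>{a<..<b} - S. (g has_vector_derivative d s) (at s)) \<and>
     ((\<lambda>s. f (g s) * norm (d s)) has_integral I) {a..b})"

lemma curve_integral_eq_arc_integral:
  assumes "has_arc_integral g f 0 1 I"
  shows "curve_integral g f = I"
proof -
  obtain S d where S: "finite S" "\<And>s. s \<in> {0<..<1} - S \<Longrightarrow> (g has_vector_derivative d s) (at s)"
    "((\<lambda>s. f (g s) * norm (d s)) has_integral I) {0..1}"
    using assms unfolding has_arc_integral_def by blast
  have "vector_derivative g (at s within {0..1}) = d s" if "s \<in> {0..1} - (insert 0 (insert 1 S))" for s
    using that S(2)[of s]
    by (intro vector_derivative_within_cbox[where a=0 and b=1, simplified]) 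
      (auto intro: has_vector_derivative_at_within)
  then have "((\<lambda>s. f (g s) * norm (vector_derivative g (at s within {0..1}))) has_integral I) {0..1}"
    using S(1) by (intro has_integral_spike_finite[OF _ _ S(3), of "insert 0 (insert 1 S)"]) auto
  then show ?thesis unfolding curve_integral_def by (rule integral_unique)
qed

lemma has_arc_integral_cong:
  assumes "has_arc_integral g f a b I" and eq: "\<And>s. s \<in> {a..b} \<Longrightarrow> g' s = g s"
  shows "has_arc_integral g' f a b I"
proof -
  obtain S d where S: "finite S" "\<And>s. s \<in> {a<..<b} - S \<Longrightarrow> (g has_vector_derivative d s) (at s)"
    "((\<lambda>s. f (g s) * norm (d s)) has_integral I) {a..b}"
    using assms(1) unfolding has_arc_integral_def by blast
  have "(g' has_vector_derivative d s) (at s)" if "s \<in> {a<..<b} - S" for s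
    using that eq by (intro has_vector_derivative_transform_within_open[OF S(2)[OF that], of "{a<..<b}"]) auto
  moreover have "((\<lambda>s. f (g' s) * norm (d s)) has_integral I) {a..b}"
    using eq by (intro has_integral_eq[OF _ S(3)]) auto
  ultimately show ?thesis unfolding has_arc_integral_def using S(1) by blast
qed

lemma has_arc_integral_combine:
  assumes 1: "has_arc_integral g f a b I" and 2: "has_arc_integral g f b c J" and le: "a \<le> b" "b \<le> c"
  shows "has_arc_integral g f a c (I + J)"
proof -
  obtain S d where S: "finite S" "\<And>s. s \<in> {a<..<b} - S \<Longrightarrow> (g has_vector_derivative d s) (at s)"
    "((\<lambda>s. f (g s) * norm (d s)) has_integral I) {a..b}"
    using 1 unfolding has_arc_integral_def by blast
  obtain T e where T: "finite T" "\<And>s. s \<in> {b<..<c} - T \<Longrightarrow> (g has_vector_derivative e s) (at s)"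
    "((\<lambda>s. f (g s) * norm (e s)) has_integral J) {b..c}"
    using 2 unfolding has_arc_integral_def by blast
  define u where "u s = (if s < b then d s else e s)" for s
  have "((\<lambda>s. f (g s) * norm (u s)) has_integral I) {a..b}"
    by (rule has_integral_spike_finite[OF _ _ S(3), of "{b}"]) (auto simp: u_def)
  moreover have "((\<lambda>s. f (g s) * norm (u s)) has_integral J) {b..c}"
    by (rule has_integral_eq[OF _ T(3)]) (auto simp: u_def)
  ultimately have "((\<lambda>s. f (g s) * norm (u s)) has_integral (I + J)) {a..c}"
    using le by (intro has_integral_combine)
  moreover have "(g has_vector_derivative u s) (at s)" if "s \<in> {a<..<c} - (insert b (S \<union> T))" for s
    using that S(2)[of s] T(2)[of s] by (auto simp: u_def)
  ultimately show ?thesis unfolding has_arc_integral_def using S(1) T(1)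
    by (intro exI[of _ "insert b (S \<union> T)"] exI[of _ u]) auto
qed

lemma has_arc_integral_split:
  assumes "has_arc_integral g f a c I" and "a \<le> b" "b \<le> c"
  shows "\<exists>J K. has_arc_integral g f a b J \<and> has_arc_integral g f b c K \<and> J + K = I"
proof -
  obtain S d where S: "finite S" "\<And>s. s \<in> {a<..<c} - S \<Longrightarrow> (g has_vector_derivative d s) (at s)"
    "((\<lambda>s. f (g s) * norm (d s)) has_integral I) {a..c}"
    using assms(1) unfolding has_arc_integral_def by blast
  have int: "(\<lambda>s. f (g s) * norm (d s)) integrable_on {a..c}" using S(3) by blast
  have "(\<lambda>s. f (g s) * norm (d s)) integrable_on {a..b}" "(\<lambda>s. f (g s) * norm (d s)) integrable_on {b..c}"
    using assms(2,3) by (auto intro: integrable_subinterval_real[OF int])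
  then obtain J K where JK: "((\<lambda>s. f (g s) * norm (d s)) has_integral J) {a..b}"
    "((\<lambda>s. f (g s) * norm (d s)) has_integral K) {b..c}"
    unfolding integrable_on_def by blast
  have "J + K = I"
    using has_integral_combine[OF assms(2,3) JK] S(3) by (rule has_integral_unique)
  moreover have "has_arc_integral g f a b J" "has_arc_integral g f b c K"
    unfolding has_arc_integral_def using S JK assms(2,3) by (auto intro!: exI[of _ S] exI[of _ d])
  ultimately show ?thesis by blast
qed

lemma has_arc_integral_affine:
  assumes "has_arc_integral g f a b I" and m: "m > 0"
  shows "has_arc_integral (\<lambda>s. g (m * s + c)) f ((a - c) / m) ((b - c) / m) I"
proof -
  obtain S d where S: "finite S" "\<And>s. s \<in> {a<..<b} - S \<Longrightarrow> (g has_vector_derivative d s) (at s)"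
    "((\<lambda>s. f (g s) * norm (d s)) has_integral I) {a..b}"
    using assms(1) unfolding has_arc_integral_def by blast
  have "((\<lambda>s. f (g (m * s + c)) * norm (d (m * s + c))) has_integral I / m) {(a - c) / m..(b - c) / m}"
    using has_integral_affinity'[of "\<lambda>s. f (g s) * norm (d s)" I a b m c] S(3) m
    by (simp add: divide_inverse mult.commute)
  from has_integral_mult_right[OF this, of m]
  have int: "((\<lambda>s. f (g (m * s + c)) * norm (m *\<^sub>R d (m * s + c))) has_integral I) {(a - c) / m..(b - c) / m}"
    using m by (simp add: mult_ac)
  have dg: "((\<lambda>s. g (m * s + c)) has_vector_derivative m *\<^sub>R d (m * s + c)) (at s)"
    if s: "s \<in> {(a - c) / m<..<(b - c) / m} - (\<lambda>x. (x - c) / m) ` S" for s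
  proof -
    have "m * s + c \<in> {a<..<b} - S"
    proof -
      have "m * s + c \<notin> S"
      proof
        assume "m * s + c \<in> S"
        then have "(m * s + c - c) / m \<in> (\<lambda>x. (x - c) / m) ` S" by blast
        then show False using s m by simp
      qed
      then show ?thesis using s m by (auto simp: field_simps)
    qed
    from S(2)[OF this] have "(g has_vector_derivative d (m * s + c)) (at (m * s + c))" .
    moreover have "((\<lambda>s. m * s + c) has_vector_derivative m) (at s)"
      by (auto simp: has_real_derivative_iff_has_vector_derivative[symmetric] intro!: derivative_eq_intros)
    ultimately show ?thesis
      using vector_diff_chain_at[of "\<lambda>s. m * s + c" m s g "d (m * s + c)"] by (simp add: o_def)
  qed
  show ?thesis
    unfolding has_arc_integral_def
  proof (intro exI conjI ballI)
    show "finite ((\<lambda>x. (x - c) / m) ` S)" using S(1) by simp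
  qed (rule dg int; assumption?)+
qed

section \<open>Joining closed curves\<close>

text \<open>The curve \<open>g\<close> is closed, passes through all but finitely many points of \<open>A\<close> exactly once, and \<open>\<mu>\<close> is its arc length
  integral on continuous functions. All that later arguments need to know about \<open>g\<close> is \<open>A\<close> and \<open>\<mu>\<close>.\<close>

definition traverses :: "(real \<Rightarrow> real^3) \<Rightarrow> (real^3) set \<Rightarrow> ((real^3 \<Rightarrow> real) \<Rightarrow> real) \<Rightarrow> bool" where
  "traverses g A \<mu> \<longleftrightarrow> path g \<and> closed_curve g \<and> path_image g = A \<and> piecewise_smooth g \<and>
     finitely_many_self_intersections g \<and>
     (\<forall>f. continuous_on UNIV f \<longrightarrow> has_arc_integral g f 0 1 (\<mu> f))"

text \<open>A closed curve can be started at any of its points. The parameters in \<open>{0..<1}\<close> are permuted cyclically, so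
  the multiple points stay the same.\<close>

lemma traverses_rebase:
  assumes g: "traverses g A \<mu>" and p: "p \<in> A"
  shows "\<exists>g'. traverses g' A \<mu> \<and> pathstart g' = p"
proof -
  from g have pg: "path g" and cl: "pathfinish g = pathstart g" and im: "path_image g = A"
    and ps: "smooth_chain g 0 1" and fm: "finitely_many_self_intersections g"
    and int: "\<And>f. continuous_on UNIV f \<Longrightarrow> has_arc_integral g f 0 1 (\<mu> f)"
    by (auto simp: traverses_def closed_curve_def piecewise_smooth_iff_chain)
  have g01: "g 1 = g 0" using cl by (simp add: pathfinish_def pathstart_def)
  \<comment> \<open>The end parameter \<open>1\<close> is replaced by \<open>0\<close>, so that the shift permutes \<open>{0..<1}\<close>.\<close>
  obtain a where a: "0 \<le> a" "a < 1" "g a = p"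
  proof -
    obtain a where a: "a \<in> {0..1}" "g a = p" using p im by (auto simp: path_image_def)
    show ?thesis
    proof (cases "a = 1")
      case True
      then show ?thesis using that[of 0] a g01 by simp
    next
      case False
      then show ?thesis using that[of a] a by auto
    qed
  qed
  define g' where "g' = shiftpath a g"
  have left: "g' s = g (1 * s + a)" if "s \<in> {0..1 - a}" for s
    using that by (simp add: g'_def shiftpath_def add.commute)
  have right: "g' s = g (1 * s + (a - 1))" if "s \<in> {1 - a..1}" for s
    using that g01 by (cases "s = 1 - a") (auto simp: g'_def shiftpath_def algebra_simps)
  have "smooth_chain g 0 a" "smooth_chain g a 1" using smooth_chain_split[OF ps a(1)] a by auto
  from smooth_chain_affine[OF this(2), of 1 a] smooth_chain_affine[OF this(1), of 1 "a - 1"]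
  have "smooth_chain g' 0 (1 - a)" "smooth_chain g' (1 - a) 1"
    using left right by (auto elim!: smooth_chain_cong)
  then have "smooth_chain g' 0 1" by (metis smooth_chain_trans)
  moreover have "has_arc_integral g' f 0 1 (\<mu> f)" if f: "continuous_on UNIV f" for f
  proof -
    obtain J K where JK: "has_arc_integral g f 0 a J" "has_arc_integral g f a 1 K" "J + K = \<mu> f"
      using has_arc_integral_split[OF int[OF f] a(1)] a by auto
    have "has_arc_integral g' f 0 (1 - a) K"
      using has_arc_integral_affine[OF JK(2), of 1 a] left by (auto elim!: has_arc_integral_cong simp del: mult_1)
    moreover have "has_arc_integral g' f (1 - a) 1 J"
      using has_arc_integral_affine[OF JK(1), of 1 "a - 1"] right by (auto elim!: has_arc_integral_cong simp del: mult_1)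
    ultimately have "has_arc_integral g' f 0 1 (K + J)"
      using a by (intro has_arc_integral_combine[of g' f 0 "1 - a"]) auto
    then show ?thesis using JK(3) by (simp add: add.commute)
  qed
  moreover have "finitely_many_self_intersections g'"
  proof -
    define u where "u s = (if a + s < 1 then a + s else a + s - 1)" for s :: real
    have g'u: "g' s = g (u s)" if "s \<in> {0..<1}" for s
      using g01 by (auto simp: g'_def shiftpath_def u_def not_less)
    have u01: "u s \<in> {0..<1}" if "s \<in> {0..<1}" for s using that a by (auto simp: u_def)
    have uinj: "s = s'" if "u s = u s'" "s \<in> {0..<1}" "s' \<in> {0..<1}" for s s'
      using that by (auto simp: u_def split: if_splits)
    have "{x \<in> g' ` {0..<1}. \<not> (\<exists>!s. s \<in> {0..<1} \<and> g' s = x)} \<subseteq>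
        {x \<in> g ` {0..<1}. \<not> (\<exists>!s. s \<in> {0..<1} \<and> g s = x)}"
    proof
      fix x assume "x \<in> {x \<in> g' ` {0..<1}. \<not> (\<exists>!s. s \<in> {0..<1} \<and> g' s = x)}"
      then obtain s where s: "s \<in> {0..<1}" "g' s = x" and no: "\<not> (\<exists>!s. s \<in> {0..<1} \<and> g' s = x)" by blast
      have "\<not> (\<exists>!s. s \<in> {0..<1} \<and> g s = x)"
      proof
        assume ex: "\<exists>!s. s \<in> {0..<1} \<and> g s = x"
        have "s' = s" if s': "s' \<in> {0..<1}" "g' s' = x" for s'
        proof -
          have "g (u s') = x" "g (u s) = x" using g'u s s' by auto
          then have "u s' = u s" using ex u01[OF s(1)] u01[OF s'(1)] by blast
          then show ?thesis using uinj s s' by blast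
        qed
        then show False using no s by blast
      qed
      moreover have "x \<in> g ` {0..<1}" using g'u[OF s(1)] u01[OF s(1)] s(2) by auto
      ultimately show "x \<in> {x \<in> g ` {0..<1}. \<not> (\<exists>!s. s \<in> {0..<1} \<and> g s = x)}" by blast
    qed
    then show ?thesis
      using fm unfolding finitely_many_self_intersections_def by (rule finite_subset)
  qed
  moreover have "path g'" "path_image g' = A" "pathstart g' = p" "pathfinish g' = pathstart g'"
    using path_shiftpath[OF pg cl] path_image_shiftpath[of a g] cl a im
      pathstart_shiftpath[of a g] closed_shiftpath[OF cl, of a]
    by (auto simp: g'_def)
  ultimately show ?thesis
    unfolding traverses_def closed_curve_def piecewise_smooth_iff_chain by blast
qed

text \<open>Both curves are started at a common point and run through one after the other. Besides the old
  multiple points, only points of \<open>A \<inter> B\<close> can become multiple.\<close>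

lemma traverses_join:
  assumes g: "traverses g A \<mu>" and c: "traverses c B \<nu>" and fin: "finite (A \<inter> B)" and meet: "A \<inter> B \<noteq> {}"
  shows "\<exists>g'. traverses g' (A \<union> B) (\<lambda>f. \<mu> f + \<nu> f)"
proof -
  obtain p where p: "p \<in> A" "p \<in> B" using meet by blast
  obtain g1 where g1: "traverses g1 A \<mu>" "pathstart g1 = p" using traverses_rebase[OF g p(1)] by blast
  obtain c1 where c1: "traverses c1 B \<nu>" "pathstart c1 = p" using traverses_rebase[OF c p(2)] by blast
  from g1 have pg: "path g1" and g1p: "g1 0 = p" "g1 1 = p" and img: "path_image g1 = A"
    and psg: "smooth_chain g1 0 1" and fmg: "finitely_many_self_intersections g1"
    and intg: "\<And>f. continuous_on UNIV f \<Longrightarrow> has_arc_integral g1 f 0 1 (\<mu> f)"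
    by (auto simp: traverses_def closed_curve_def piecewise_smooth_iff_chain pathstart_def pathfinish_def)
  from c1 have pc: "path c1" and c1p: "c1 0 = p" "c1 1 = p" and imc: "path_image c1 = B"
    and psc: "smooth_chain c1 0 1" and fmc: "finitely_many_self_intersections c1"
    and intc: "\<And>f. continuous_on UNIV f \<Longrightarrow> has_arc_integral c1 f 0 1 (\<nu> f)"
    by (auto simp: traverses_def closed_curve_def piecewise_smooth_iff_chain pathstart_def pathfinish_def)
  define h where "h = g1 +++ c1"
  have left: "h s = g1 (2 * s + 0)" if "s \<in> {0..1 / 2}" for s
    using that by (simp add: h_def joinpaths_def)
  have right: "h s = c1 (2 * s + (- 1))" if "s \<in> {1 / 2..1}" for s
  proof (cases "s = 1 / 2")
    case True
    then show ?thesis by (simp only: h_def joinpaths_def True) (simp add: g1p c1p)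
  next
    case False
    then show ?thesis using that by (simp add: h_def joinpaths_def)
  qed
  have "smooth_chain h 0 (1 / 2)"
    using smooth_chain_affine[OF psg, of 2 0] left by (auto elim!: smooth_chain_cong)
  moreover have "smooth_chain h (1 / 2) 1"
    using smooth_chain_affine[OF psc, of 2 "-1"] right by (auto elim!: smooth_chain_cong)
  ultimately have "smooth_chain h 0 1" by (metis smooth_chain_trans)
  moreover have "has_arc_integral h f 0 1 (\<mu> f + \<nu> f)" if f: "continuous_on UNIV f" for f
  proof (rule has_arc_integral_combine)
    show "has_arc_integral h f 0 (1 / 2) (\<mu> f)"
      using has_arc_integral_affine[OF intg[OF f], of 2 0] left by (auto elim!: has_arc_integral_cong)
    show "has_arc_integral h f (1 / 2) 1 (\<nu> f)"
      using has_arc_integral_affine[OF intc[OF f], of 2 "-1"] right by (auto elim!: has_arc_integral_cong)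
  qed auto
  moreover have "finitely_many_self_intersections h"
  proof -
    let ?bad = "\<lambda>g :: real \<Rightarrow> real^3. {x \<in> g ` {0..<1}. \<not> (\<exists>!s. s \<in> {0..<1} \<and> g s = x)}"
    have inA: "g1 s \<in> A" if "0 \<le> s" "s \<le> 1" for s using that img by (auto simp: path_image_def)
    have inB: "c1 s \<in> B" if "0 \<le> s" "s \<le> 1" for s using that imc by (auto simp: path_image_def)
    have sub: "?bad h \<subseteq> ?bad g1 \<union> ?bad c1 \<union> (A \<inter> B)"
    proof (rule subsetI, rule ccontr)
      fix x assume x: "x \<in> ?bad h" and nx: "x \<notin> ?bad g1 \<union> ?bad c1 \<union> (A \<inter> B)"
      obtain s where s01: "s \<in> {0..<1}" and hs: "h s = x" using x by blast
      have "\<not> (\<exists>!s. s \<in> {0..<1} \<and> h s = x)" using x by simp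
      then obtain s' where s'01: "s' \<in> {0..<1}" and hs': "h s' = x" and ne: "s' \<noteq> s"
        using s01 hs by blast
      have s: "0 \<le> s" "s < 1" "h s = x" and s': "0 \<le> s'" "s' < 1" "h s' = x" "s' \<noteq> s"
        using s01 s'01 hs hs' ne by simp_all
      have half: "s \<le> 1 / 2 \<and> 2 * s < 1 \<and> x = g1 (2 * s) \<and> x \<in> A \<or>
          1 / 2 < s \<and> x = c1 (2 * s - 1) \<and> x \<in> B" if "0 \<le> s" "s < 1" "h s = x" for s
      proof (cases "s \<le> 1 / 2")
        case True
        then have x: "x = g1 (2 * s)" "x \<in> A" using left[of s] inA[of "2 * s"] that by simp_all
        have "s \<noteq> 1 / 2"
        proof
          assume "s = 1 / 2"
          then have "2 * s = 1" by simp
          then have "x = p" using x(1) g1p(2) by (simp only:)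
          then show False using p nx by simp
        qed
        then show ?thesis using True x by simp
      next
        case False
        then show ?thesis using right[of s] inB[of "2 * s - 1"] that by simp
      qed
      have A: "s = s'" if "x = g1 (2 * s)" "x = g1 (2 * s')" "2 * s < 1" "2 * s' < 1"
      proof -
        have m: "2 * s \<in> {0..<1}" "2 * s' \<in> {0..<1}" using that s s' by auto
        then have "x \<in> g1 ` {0..<1}" using that by auto
        then have "\<exists>!r. r \<in> {0..<1} \<and> g1 r = x" using nx by blast
        then have "2 * s = 2 * s'" using that m by metis
        then show ?thesis by simp
      qed
      have B: "s = s'" if "x = c1 (2 * s - 1)" "x = c1 (2 * s' - 1)" "1 / 2 < s" "1 / 2 < s'"
      proof -
        have m: "2 * s - 1 \<in> {0..<1}" "2 * s' - 1 \<in> {0..<1}" using that s s' by auto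
        then have "x \<in> c1 ` {0..<1}" using that by auto
        then have "\<exists>!r. r \<in> {0..<1} \<and> c1 r = x" using nx by blast
        then have "2 * s - 1 = 2 * s' - 1" using that m by metis
        then show ?thesis by simp
      qed
      have nAB: "\<not> (x \<in> A \<and> x \<in> B)" using nx by simp
      from half[OF s] show False
      proof
        assume 1: "s \<le> 1 / 2 \<and> 2 * s < 1 \<and> x = g1 (2 * s) \<and> x \<in> A"
        from half[OF s'(1-3)] show False
        proof
          assume "s' \<le> 1 / 2 \<and> 2 * s' < 1 \<and> x = g1 (2 * s') \<and> x \<in> A"
          with 1 have "s = s'" by (intro A) simp_all
          with s'(4) show False by simp
        next
          assume "1 / 2 < s' \<and> x = c1 (2 * s' - 1) \<and> x \<in> B"
          with 1 nAB show False by blast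
        qed
      next
        assume 1: "1 / 2 < s \<and> x = c1 (2 * s - 1) \<and> x \<in> B"
        from half[OF s'(1-3)] show False
        proof
          assume "s' \<le> 1 / 2 \<and> 2 * s' < 1 \<and> x = g1 (2 * s') \<and> x \<in> A"
          with 1 nAB show False by blast
        next
          assume "1 / 2 < s' \<and> x = c1 (2 * s' - 1) \<and> x \<in> B"
          with 1 have "s = s'" by (intro B) simp_all
          with s'(4) show False by simp
        qed
      qed
    qed
    have "finite (?bad g1 \<union> ?bad c1 \<union> (A \<inter> B))"
      using fmg fmc fin unfolding finitely_many_self_intersections_def by (intro finite_UnI)
    then show ?thesis
      unfolding finitely_many_self_intersections_def by (rule finite_subset[OF sub])
  qed
  moreover have "path h" "path_image h = A \<union> B" "pathfinish h = pathstart h"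
  proof -
    have "pathfinish g1 = pathstart c1" "pathfinish c1 = pathstart g1"
      using g1p c1p by (simp_all add: pathstart_def pathfinish_def)
    then show "path h" "path_image h = A \<union> B" "pathfinish h = pathstart h"
      using pg pc img imc by (simp_all add: h_def path_image_join)
  qed
  ultimately show ?thesis
    unfolding traverses_def closed_curve_def piecewise_smooth_iff_chain by blast
qed

text \<open>Each curve is inserted at a point of \<open>A\<close>, so the inserted curves may be disjoint from each other; what has to
  be excluded is that two of them share infinitely many points.\<close>

lemma traverses_UN:
  assumes "finite F" and "\<exists>g. traverses g A \<mu>"
    and "\<And>i. i \<in> F \<Longrightarrow> \<exists>c. traverses c (B i) (\<nu> i)"
    and "\<And>i. i \<in> F \<Longrightarrow> finite (A \<inter> B i) \<and> A \<inter> B i \<noteq> {}"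
    and "\<And>i j. i \<in> F \<Longrightarrow> j \<in> F \<Longrightarrow> i \<noteq> j \<Longrightarrow> finite (B i \<inter> B j)"
  shows "\<exists>g. traverses g (A \<union> (\<Union>i\<in>F. B i)) (\<lambda>f. \<mu> f + (\<Sum>i\<in>F. \<nu> i f))"
  using assms
proof (induction F rule: finite_induct)
  case empty
  then show ?case by simp
next
  case (insert k F)
  then obtain g where g: "traverses g (A \<union> (\<Union>i\<in>F. B i)) (\<lambda>f. \<mu> f + (\<Sum>i\<in>F. \<nu> i f))" by blast
  obtain c where c: "traverses c (B k) (\<nu> k)" using insert by blast
  have "(A \<union> (\<Union>i\<in>F. B i)) \<inter> B k = (A \<inter> B k) \<union> (\<Union>i\<in>F. B i \<inter> B k)" by blast
  moreover have "finite (\<Union>i\<in>F. B i \<inter> B k)"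
    using insert.prems(4)[of _ k] insert.hyps by (intro finite_UN_I) auto
  ultimately have "finite ((A \<union> (\<Union>i\<in>F. B i)) \<inter> B k)"
    using insert.hyps insert.prems(3)[of k] by simp
  moreover have "(A \<union> (\<Union>i\<in>F. B i)) \<inter> B k \<noteq> {}" using insert.prems(3)[of k] by blast
  ultimately obtain g' where "traverses g' ((A \<union> (\<Union>i\<in>F. B i)) \<union> B k) (\<lambda>f. \<mu> f + (\<Sum>i\<in>F. \<nu> i f) + \<nu> k f)"
    using traverses_join[OF g c] by blast
  moreover have "(A \<union> (\<Union>i\<in>F. B i)) \<union> B k = A \<union> (\<Union>i\<in>insert k F. B i)" by blast
  moreover have "(\<lambda>f. \<mu> f + (\<Sum>i\<in>F. \<nu> i f) + \<nu> k f) = (\<lambda>f. \<mu> f + (\<Sum>i\<in>insert k F. \<nu> i f))"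
    using insert.hyps by (simp add: add_ac)
  ultimately show ?case by metis
qed



section \<open>Latitude circles\<close>

text \<open>Each derivative multiplies by \<open>w\<close> and turns the angle by \<open>\<pi> / 2\<close>.\<close>

lemma smooth_on_interval_circle:
  "smooth_on_interval (\<lambda>s. A + cos (w * s) *\<^sub>R B + sin (w * s) *\<^sub>R C) a b"
proof -
  define D where "D k s = (if k = 0 then A else 0) + (w ^ k * cos (w * s + real k * (pi / 2))) *\<^sub>R B +
    (w ^ k * sin (w * s + real k * (pi / 2))) *\<^sub>R C" for k s
  have shift: "cos (x + real (Suc k) * (pi / 2)) = - sin (x + real k * (pi / 2))"
    "sin (x + real (Suc k) * (pi / 2)) = cos (x + real k * (pi / 2))" for x k
  proof -
    have "x + real (Suc k) * (pi / 2) = (x + real k * (pi / 2)) + pi / 2" by (simp add: field_simps)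
    then show "cos (x + real (Suc k) * (pi / 2)) = - sin (x + real k * (pi / 2))"
      "sin (x + real (Suc k) * (pi / 2)) = cos (x + real k * (pi / 2))"
      by (simp_all only: cos_add[of _ "pi / 2"] sin_add[of _ "pi / 2"]) simp_all
  qed
  have "(D k has_vector_derivative D (Suc k) s) (at s within {a..b})" for k s
    unfolding D_def shift
    by (auto intro!: derivative_eq_intros simp: has_vector_derivative_def[symmetric] algebra_simps)
  moreover have "D 0 = (\<lambda>s. A + cos (w * s) *\<^sub>R B + sin (w * s) *\<^sub>R C)" by (rule ext) (simp add: D_def)
  ultimately show ?thesis unfolding smooth_on_interval_def by blast
qed

text \<open>The parametrization has constant speed because \<open>B\<close> and \<open>C\<close> are orthogonal and of equal length, and it has no
  self-intersections because \<open>B\<close> and \<open>C\<close> recover the cosine and the sine of the angle.\<close>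

lemma traverses_circle:
  fixes A B C :: "real^3"
  assumes orth: "B \<bullet> C = 0" and nB: "norm B = \<rho>" and nC: "norm C = \<rho>" and \<rho>: "\<rho> > 0"
  shows "traverses (\<lambda>s. A + cos (2 * pi * s) *\<^sub>R B + sin (2 * pi * s) *\<^sub>R C)
    (range (\<lambda>\<phi>. A + cos \<phi> *\<^sub>R B + sin \<phi> *\<^sub>R C))
    (\<lambda>f. integral {0..2 * pi} (\<lambda>\<phi>. f (A + cos \<phi> *\<^sub>R B + sin \<phi> *\<^sub>R C) * \<rho>))"
proof -
  define q where "q \<phi> = A + cos \<phi> *\<^sub>R B + sin \<phi> *\<^sub>R C" for \<phi>
  define g where "g s = q (2 * pi * s)" for s
  have BB: "B \<bullet> B = \<rho>\<^sup>2" and CC: "C \<bullet> C = \<rho>\<^sup>2" using nB nC by (auto simp: dot_square_norm)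
  have cont: "continuous_on X q" for X unfolding q_def by (intro continuous_intros)
  have contg: "continuous_on X g" for X
    unfolding g_def by (intro continuous_on_compose2[OF cont] continuous_intros) auto
  have dq: "(q has_vector_derivative (- sin \<phi>) *\<^sub>R B + cos \<phi> *\<^sub>R C) (at \<phi>)" for \<phi>
    unfolding q_def by (auto intro!: derivative_eq_intros simp: has_vector_derivative_def[symmetric] algebra_simps)
  have ndq: "norm ((- sin \<phi>) *\<^sub>R B + cos \<phi> *\<^sub>R C) = \<rho>" for \<phi>
  proof -
    have "(norm ((- sin \<phi>) *\<^sub>R B + cos \<phi> *\<^sub>R C))\<^sup>2 = ((sin \<phi>)\<^sup>2 + (cos \<phi>)\<^sup>2) * \<rho>\<^sup>2"
      unfolding power2_norm_eq_inner
      by (simp add: inner_add_left inner_add_right inner_diff_left inner_diff_right BB CC orth inner_commute[of C B] 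
          power2_eq_square algebra_simps del: sin_cos_squared_add sin_cos_squared_add2 sin_cos_squared_add3)
    then show ?thesis using \<rho> by (simp add: power2_eq_iff_nonneg)
  qed
  have arc: "has_arc_integral g f 0 1 (integral {0..2 * pi} (\<lambda>\<phi>. f (q \<phi>) * \<rho>))" if f: "continuous_on UNIV f" for f
  proof -
    have "(\<lambda>\<phi>. f (q \<phi>) * \<rho>) integrable_on {0..2 * pi}"
      by (intro integrable_continuous_real continuous_intros continuous_on_compose2[OF f cont]) auto
    then have "has_arc_integral q f 0 (2 * pi) (integral {0..2 * pi} (\<lambda>\<phi>. f (q \<phi>) * \<rho>))"
      unfolding has_arc_integral_def
      by (intro exI[of _ "{}"] exI[of _ "\<lambda>\<phi>. (- sin \<phi>) *\<^sub>R B + cos \<phi> *\<^sub>R C"] conjI ballI dq)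
        (simp_all only: ndq integrable_integral finite.emptyI)
    from has_arc_integral_affine[OF this, of "2 * pi" 0] show ?thesis by (simp add: g_def[abs_def])
  qed
  have inj: "s = s'" if "s \<in> {0..<1}" "s' \<in> {0..<1}" "g s = g s'" for s s'
  proof -
    have eq: "cos (2 * pi * s) *\<^sub>R B + sin (2 * pi * s) *\<^sub>R C = cos (2 * pi * s') *\<^sub>R B + sin (2 * pi * s') *\<^sub>R C"
      using that(3) by (simp add: g_def q_def add.assoc)
    have "cos (2 * pi * s) = cos (2 * pi * s')"
      using arg_cong[OF eq, of "\<lambda>x. x \<bullet> B"] \<rho> by (simp add: inner_add_left BB orth inner_commute[of C B])
    moreover have "sin (2 * pi * s) = sin (2 * pi * s')"
      using arg_cong[OF eq, of "\<lambda>x. x \<bullet> C"] \<rho> by (simp add: inner_add_left CC orth)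
    ultimately obtain n :: int where "2 * pi * s = 2 * pi * s' + 2 * pi * of_int n"
      using sin_cos_eq_iff[of "2 * pi * s" "2 * pi * s'"] by (auto simp: mult_ac)
    then have "2 * pi * s = 2 * pi * (s' + of_int n)" by (simp add: distrib_left)
    then have n: "s = s' + of_int n" by simp
    then have "n < 1" "n > - 1" using that(1,2) by auto
    then show ?thesis using n by simp
  qed
  have range: "path_image g = range q"
  proof
    show "range q \<subseteq> path_image g"
    proof
      fix x assume "x \<in> range q"
      then obtain \<phi> where x: "x = q \<phi>" by blast
      obtain t where "0 \<le> t" "t < 2 * pi" "cos \<phi> = cos t" "sin \<phi> = sin t"
        using sincos_total_2pi[of "cos \<phi>" "sin \<phi>"] by auto
      then have "x = g (t / (2 * pi))" "t / (2 * pi) \<in> {0..1}" by (auto simp: x g_def q_def)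
      then show "x \<in> path_image g" unfolding path_image_def by blast
    qed
  qed (auto simp: path_image_def g_def)
  have "finitely_many_self_intersections g"
  proof -
    have "{x \<in> g ` {0..<1}. \<not> (\<exists>!s. s \<in> {0..<1} \<and> g s = x)} = {}" using inj by blast
    then show ?thesis unfolding finitely_many_self_intersections_def by (simp only: finite.emptyI)
  qed
  moreover have "smooth_chain g 0 1"
    by (rule chain_step[OF chain_refl]) (simp_all add: g_def[abs_def] q_def smooth_on_interval_circle)
  ultimately have "traverses g (range q) (\<lambda>f. integral {0..2 * pi} (\<lambda>\<phi>. f (q \<phi>) * \<rho>))"
    unfolding traverses_def closed_curve_def piecewise_smooth_iff_chain
    using arc range contg by (auto simp: path_def g_def q_def pathstart_def pathfinish_def)
  then show ?thesis by (simp add: g_def[abs_def] q_def[abs_def])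
qed

definition swap_axes :: "real^3 \<Rightarrow> real^3" where
  "swap_axes v = vector [v $ 3, v $ 2, v $ 1]"

definition latitude_circle :: "3 \<Rightarrow> real \<Rightarrow> (real^3) set" where
  "latitude_circle k \<theta> = {x \<in> sphere 0 1. x $ k = cos \<theta>}"

text \<open>The arc length integral over the circle of colatitude \<open>\<theta>\<close> about the third axis, which has radius
  \<open>sin \<theta>\<close> for \<open>0 < \<theta> < \<pi>\<close>.\<close>

definition latitude_integral :: "real \<Rightarrow> (real^3 \<Rightarrow> real) \<Rightarrow> real" where
  "latitude_integral \<theta> f = integral {0..2 * pi} (\<lambda>\<phi>. f (spherical_coords (\<theta>, \<phi>)) * sin \<theta>)"

lemma norm_real3: "(norm (x :: real^3))\<^sup>2 = (x $ 1)\<^sup>2 + (x $ 2)\<^sup>2 + (x $ 3)\<^sup>2"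
  unfolding power2_norm_eq_inner by (simp add: inner_vec_def sum_3 power2_eq_square)

lemma in_sphere_real3: "x \<in> sphere 0 1 \<longleftrightarrow> (x $ 1)\<^sup>2 + (x $ 2)\<^sup>2 + ((x :: real^3) $ 3)\<^sup>2 = 1"
  unfolding norm_real3[symmetric] by (simp add: power2_eq_1_iff) (smt (verit) norm_ge_zero)

lemma swap_axes_simps [simp]:
  "swap_axes v $ 1 = v $ 3" "swap_axes v $ 2 = v $ 2" "swap_axes v $ 3 = v $ 1"
  by (simp_all add: swap_axes_def)

lemma swap_axes_swap_axes [simp]: "swap_axes (swap_axes v) = v"
  by (simp add: vec_eq_iff forall_3)

lemma latitude_circle_3_eq_range:
  assumes "sin \<theta> > 0"
  shows "latitude_circle 3 \<theta> = range (\<lambda>\<phi>. spherical_coords (\<theta>, \<phi>))"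
proof
  show "latitude_circle 3 \<theta> \<subseteq> range (\<lambda>\<phi>. spherical_coords (\<theta>, \<phi>))"
  proof
    fix x assume "x \<in> latitude_circle 3 \<theta>"
    then have x: "(x $ 1)\<^sup>2 + (x $ 2)\<^sup>2 + (x $ 3)\<^sup>2 = 1" "x $ 3 = cos \<theta>"
      by (auto simp: latitude_circle_def in_sphere_real3 simp del: mem_sphere_0 mem_sphere)
    then have "(x $ 1)\<^sup>2 + (x $ 2)\<^sup>2 = (sin \<theta>)\<^sup>2" by (simp add: sin_squared_eq)
    then have "(x $ 1 / sin \<theta>)\<^sup>2 + (x $ 2 / sin \<theta>)\<^sup>2 = 1"
      using assms by (simp add: power_divide flip: add_divide_distrib)
    then obtain t where "x $ 1 / sin \<theta> = cos t" "x $ 2 / sin \<theta> = sin t"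
      using sincos_total_2pi by metis
    then have "x = spherical_coords (\<theta>, t)"
      using x(2) assms by (simp add: spherical_coords_def vec_eq_iff forall_3 field_simps)
    then show "x \<in> range (\<lambda>\<phi>. spherical_coords (\<theta>, \<phi>))" by blast
  qed
  show "range (\<lambda>\<phi>. spherical_coords (\<theta>, \<phi>)) \<subseteq> latitude_circle 3 \<theta>"
    using spherical_coords_in_sphere by (auto simp: latitude_circle_def spherical_coords_def simp del: mem_sphere_0 mem_sphere)
qed

lemma latitude_circle_1_eq: "latitude_circle 1 \<theta> = swap_axes ` latitude_circle 3 \<theta>"
proof
  show "latitude_circle 1 \<theta> \<subseteq> swap_axes ` latitude_circle 3 \<theta>"
  proof
    fix x assume "x \<in> latitude_circle 1 \<theta>"
    then have "swap_axes x \<in> latitude_circle 3 \<theta>"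
      by (auto simp: latitude_circle_def in_sphere_real3 add_ac simp del: mem_sphere_0 mem_sphere)
    then show "x \<in> swap_axes ` latitude_circle 3 \<theta>"
      by (metis imageI swap_axes_swap_axes)
  qed
qed (auto simp: latitude_circle_def in_sphere_real3 add_ac simp del: mem_sphere_0 mem_sphere)

lemma traverses_latitude_circle_3:
  assumes "sin \<theta> > 0"
  shows "\<exists>g. traverses g (latitude_circle 3 \<theta>) (latitude_integral \<theta>)"
proof -
  have eq: "spherical_coords (\<theta>, \<phi>) = cos \<theta> *\<^sub>R axis 3 1 + cos \<phi> *\<^sub>R (sin \<theta> *\<^sub>R axis 1 1) +
      sin \<phi> *\<^sub>R (sin \<theta> *\<^sub>R axis 2 1)" for \<phi>
    by (simp add: spherical_coords_def vec_eq_iff forall_3 axis_def)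
  show ?thesis
    unfolding latitude_circle_3_eq_range[OF assms] latitude_integral_def[abs_def] eq
    by (rule exI, rule traverses_circle) (use assms in \<open>simp_all add: inner_axis_axis\<close>)
qed

lemma traverses_latitude_circle_1:
  assumes "sin \<theta> > 0"
  shows "\<exists>g. traverses g (latitude_circle 1 \<theta>) (\<lambda>f. latitude_integral \<theta> (f \<circ> swap_axes))"
proof -
  have eq: "swap_axes (spherical_coords (\<theta>, \<phi>)) = cos \<theta> *\<^sub>R axis 1 1 + cos \<phi> *\<^sub>R (sin \<theta> *\<^sub>R axis 3 1) +
      sin \<phi> *\<^sub>R (sin \<theta> *\<^sub>R axis 2 1)" for \<phi>
    by (simp add: spherical_coords_def swap_axes_def vec_eq_iff forall_3 axis_def)
  show ?thesis
    unfolding latitude_circle_1_eq latitude_circle_3_eq_range[OF assms] image_image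
      latitude_integral_def[abs_def] o_def eq
    by (rule exI, rule traverses_circle) (use assms in \<open>simp_all add: inner_axis_axis\<close>)
qed

lemma euclidean_circle_latitude:
  assumes "sin \<theta> > 0" "k = 1 \<or> k = 3"
  shows "euclidean_circle (latitude_circle k \<theta>)"
proof -
  have "affine {x :: real^3. axis k 1 \<bullet> x = cos \<theta>}" by (rule affine_hyperplane)
  moreover have "aff_dim {x :: real^3. axis k 1 \<bullet> x = cos \<theta>} = 2"
    by (subst aff_dim_hyperplane) (simp_all add: axis_eq_0_iff)
  moreover have "latitude_circle k \<theta> = sphere 0 1 \<inter> {x. axis k 1 \<bullet> x = cos \<theta>}"
    by (auto simp: latitude_circle_def inner_axis')
  moreover have "\<exists>x\<in>latitude_circle k \<theta>. \<exists>y\<in>latitude_circle k \<theta>. x \<noteq> y"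
  proof -
    define v :: "real \<Rightarrow> real^3"
      where "v s = (\<chi> i. if i = k then cos \<theta> else if i = 2 then s * sin \<theta> else 0)" for s
    have "v s \<in> latitude_circle k \<theta>" if "s\<^sup>2 = 1" for s
      using assms(2) that
      by (auto simp: v_def latitude_circle_def in_sphere_real3 power_mult_distrib simp del: mem_sphere_0 mem_sphere)
    then have "v 1 \<in> latitude_circle k \<theta>" "v (- 1) \<in> latitude_circle k \<theta>" by simp_all
    moreover have "v 1 $ 2 \<noteq> v (- 1) $ 2" using assms by (auto simp: v_def)
    ultimately show ?thesis by metis
  qed
  ultimately show ?thesis unfolding euclidean_circle_def by blast
qed

lemma finite_latitude_circle_inter: "finite (latitude_circle 3 \<theta> \<inter> latitude_circle 1 \<theta>')"
proof (rule finite_subset)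
  let ?r = "sqrt (1 - (cos \<theta>)\<^sup>2 - (cos \<theta>')\<^sup>2)"
  show "latitude_circle 3 \<theta> \<inter> latitude_circle 1 \<theta>' \<subseteq>
      {vector [cos \<theta>', ?r, cos \<theta>], vector [cos \<theta>', - ?r, cos \<theta>]}"
  proof
    fix x assume "x \<in> latitude_circle 3 \<theta> \<inter> latitude_circle 1 \<theta>'"
    then have x: "(x $ 1)\<^sup>2 + (x $ 2)\<^sup>2 + (x $ 3)\<^sup>2 = 1" "x $ 3 = cos \<theta>" "x $ 1 = cos \<theta>'"
      by (auto simp: latitude_circle_def in_sphere_real3 simp del: mem_sphere_0 mem_sphere)
    then have "(x $ 2)\<^sup>2 = 1 - (cos \<theta>)\<^sup>2 - (cos \<theta>')\<^sup>2" by simp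
    then have "?r = \<bar>x $ 2\<bar>" by (metis real_sqrt_abs)
    then have "x $ 2 = ?r \<or> x $ 2 = - ?r" by linarith
    then show "x \<in> {vector [cos \<theta>', ?r, cos \<theta>], vector [cos \<theta>', - ?r, cos \<theta>]}"
      using x by (auto simp: vec_eq_iff forall_3)
  qed
qed simp

lemma latitude_circle_inter_nonempty:
  assumes "(cos \<theta>)\<^sup>2 + (cos \<theta>')\<^sup>2 \<le> 1"
  shows "latitude_circle 3 \<theta> \<inter> latitude_circle 1 \<theta>' \<noteq> {}"
proof -
  have "vector [cos \<theta>', sqrt (1 - (cos \<theta>)\<^sup>2 - (cos \<theta>')\<^sup>2), cos \<theta>] \<in> latitude_circle 3 \<theta> \<inter> latitude_circle 1 \<theta>'"
    using assms by (auto simp: latitude_circle_def in_sphere_real3 simp del: mem_sphere_0 mem_sphere)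
  then show ?thesis by blast
qed

lemma latitude_circle_disjoint:
  "cos \<theta> \<noteq> cos \<theta>' \<Longrightarrow> latitude_circle k \<theta> \<inter> latitude_circle k \<theta>' = {}"
  by (auto simp: latitude_circle_def)

section \<open>Exactness of two families of latitude circles\<close>

definition monomial :: "(3 \<Rightarrow> nat) \<Rightarrow> real^3 \<Rightarrow> real" where
  "monomial \<alpha> x = (\<Prod>i\<in>UNIV. (x $ i) ^ \<alpha> i)"

lemma continuous_on_monomial [continuous_intros]: "continuous_on A (monomial \<alpha>)"
  unfolding monomial_def[abs_def] by (intro continuous_intros)

lemma monomial_eq: "monomial \<alpha> x = (x $ 1) ^ \<alpha> 1 * (x $ 2) ^ \<alpha> 2 * (x $ 3) ^ \<alpha> 3"
  unfolding monomial_def UNIV_3 by (simp add: mult_ac)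

lemma monomial_spherical_coords:
  "monomial \<alpha> (spherical_coords (\<theta>, \<phi>)) * sin \<theta> =
    (cos \<phi> ^ \<alpha> 1 * sin \<phi> ^ \<alpha> 2) * (sin \<theta> ^ (\<alpha> 1 + \<alpha> 2 + 1) * cos \<theta> ^ \<alpha> 3)"
  by (simp add: monomial_eq spherical_coords_def power_mult_distrib power_add mult_ac)

lemma latitude_integral_monomial:
  "latitude_integral \<theta> (monomial \<alpha>) =
    azimuth_moment (\<alpha> 1) (\<alpha> 2) * (sin \<theta> ^ (\<alpha> 1 + \<alpha> 2 + 1) * cos \<theta> ^ \<alpha> 3)"
  unfolding latitude_integral_def monomial_spherical_coords azimuth_moment_def
  by (rule integral_mult_left)

lemma latitude_integral_sum:
  assumes "finite F" "\<And>\<alpha>. \<alpha> \<in> F \<Longrightarrow> continuous_on UNIV (m \<alpha>)"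
  shows "latitude_integral \<theta> (\<lambda>x. \<Sum>\<alpha>\<in>F. c \<alpha> * m \<alpha> x) = (\<Sum>\<alpha>\<in>F. c \<alpha> * latitude_integral \<theta> (m \<alpha>))"
proof -
  have eq: "spherical_coords (\<theta>, \<phi>) = (sin \<theta> * cos \<phi>) *\<^sub>R axis 1 1 +
      (sin \<theta> * sin \<phi>) *\<^sub>R axis 2 1 + cos \<theta> *\<^sub>R axis 3 1" for \<phi>
    by (simp add: spherical_coords_def vec_eq_iff forall_3 axis_def)
  have "continuous_on {0..2 * pi} (\<lambda>\<phi>. m \<alpha> (spherical_coords (\<theta>, \<phi>)))" if "\<alpha> \<in> F" for \<alpha>
    unfolding eq by (intro continuous_on_compose2[OF assms(2)[OF that]] continuous_intros) auto
  then have int: "(\<lambda>\<phi>. c \<alpha> * (m \<alpha> (spherical_coords (\<theta>, \<phi>)) * sin \<theta>)) integrable_on {0..2 * pi}"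
    if "\<alpha> \<in> F" for \<alpha> using that by (intro integrable_continuous_real continuous_intros)
  have "latitude_integral \<theta> (\<lambda>x. \<Sum>\<alpha>\<in>F. c \<alpha> * m \<alpha> x) =
      integral {0..2 * pi} (\<lambda>\<phi>. \<Sum>\<alpha>\<in>F. c \<alpha> * (m \<alpha> (spherical_coords (\<theta>, \<phi>)) * sin \<theta>))"
    unfolding latitude_integral_def by (simp add: sum_distrib_right mult.assoc)
  also have "\<dots> = (\<Sum>\<alpha>\<in>F. c \<alpha> * latitude_integral \<theta> (m \<alpha>))"
    unfolding latitude_integral_def using int assms(1) by (subst integral_sum) simp_all
  finally show ?thesis .
qed

lemma sphere_average_polynomial:
  assumes "finite F"
  shows "(LINT x|normalized_surface_measure. (\<Sum>\<alpha>\<in>F. c \<alpha> * monomial \<alpha> x)) =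
    1 / (4 * pi) * (\<Sum>\<alpha>\<in>F. c \<alpha> * sphere_moment (\<alpha> 1) (\<alpha> 2) (\<alpha> 3))"
proof -
  have "continuous_on UNIV (\<lambda>x. \<Sum>\<alpha>\<in>F. c \<alpha> * monomial \<alpha> x)" by (intro continuous_intros)
  then have "(LINT x|normalized_surface_measure. (\<Sum>\<alpha>\<in>F. c \<alpha> * monomial \<alpha> x)) =
      1 / (4 * pi) * integral {0..pi} (\<lambda>\<theta>. latitude_integral \<theta> (\<lambda>x. \<Sum>\<alpha>\<in>F. c \<alpha> * monomial \<alpha> x))"
    unfolding latitude_integral_def by (rule integral_normalized_surface_measure)
  also have "(\<lambda>\<theta>. latitude_integral \<theta> (\<lambda>x. \<Sum>\<alpha>\<in>F. c \<alpha> * monomial \<alpha> x)) =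
      (\<lambda>\<theta>. \<Sum>\<alpha>\<in>F. c \<alpha> * (azimuth_moment (\<alpha> 1) (\<alpha> 2) * (cos \<theta> ^ \<alpha> 3 * sin \<theta> ^ (\<alpha> 1 + \<alpha> 2 + 1))))"
    using assms by (simp add: latitude_integral_sum continuous_on_monomial latitude_integral_monomial mult_ac)
  also have "integral {0..pi} \<dots> = (\<Sum>\<alpha>\<in>F. c \<alpha> * sphere_moment (\<alpha> 1) (\<alpha> 2) (\<alpha> 3))"
    unfolding sphere_moment_def polar_moment_def using assms
    by (subst integral_sum) (auto intro!: integrable_continuous_real continuous_intros)
  finally show ?thesis .
qed

text \<open>If the exponent of \<open>x\<^sub>1\<close> or of \<open>x\<^sub>2\<close> is odd, both sides vanish on integrating over the azimuth.
  Otherwise the exponent of \<open>sin \<theta>\<close>, raised by one by the arc length, is odd, and the quadrature formula applies.\<close>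

lemma latitude_integral_quadrature:
  assumes Q: "\<And>m c. 2 * m + 1 + c \<le> Suc t \<Longrightarrow> h * (\<Sum>j<N. sin (y j) ^ (2 * m + 1) * cos (y j) ^ c) =
      integral {0..pi} (\<lambda>x. sin x ^ (2 * m + 1) * cos x ^ c)"
    and deg: "\<alpha> 1 + \<alpha> 2 + \<alpha> 3 \<le> t"
  shows "h * (\<Sum>j<N. latitude_integral (y j) (monomial \<alpha>)) = sphere_moment (\<alpha> 1) (\<alpha> 2) (\<alpha> 3)"
proof (cases "odd (\<alpha> 1) \<or> odd (\<alpha> 2)")
  case True
  then show ?thesis by (simp add: latitude_integral_monomial sphere_moment_def azimuth_moment_odd)
next
  case False
  then obtain m where m: "\<alpha> 1 + \<alpha> 2 = 2 * m" by (metis evenE odd_add)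
  have "h * (\<Sum>j<N. latitude_integral (y j) (monomial \<alpha>)) =
      azimuth_moment (\<alpha> 1) (\<alpha> 2) * (h * (\<Sum>j<N. sin (y j) ^ (2 * m + 1) * cos (y j) ^ \<alpha> 3))"
    unfolding latitude_integral_monomial m by (simp add: sum_distrib_left mult_ac)
  also have "\<dots> = azimuth_moment (\<alpha> 1) (\<alpha> 2) * integral {0..pi} (\<lambda>x. sin x ^ (2 * m + 1) * cos x ^ \<alpha> 3)"
    using deg m by (subst Q) simp_all
  also have "\<dots> = sphere_moment (\<alpha> 1) (\<alpha> 2) (\<alpha> 3)"
    unfolding sphere_moment_def polar_moment_def m by (simp add: mult.commute)
  finally show ?thesis .
qed

text \<open>Exchanging the first and the third axis maps monomials to monomials of the same degree and preserves the
  moments of the sphere, so both families contribute \<open>4 \<pi>\<close> times the mean.\<close>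

lemma latitude_circles_exact:
  assumes Q: "\<And>m c. 2 * m + 1 + c \<le> Suc t \<Longrightarrow> h * (\<Sum>j<N. sin (y j) ^ (2 * m + 1) * cos (y j) ^ c) =
      integral {0..pi} (\<lambda>x. sin x ^ (2 * m + 1) * cos x ^ c)"
    and f: "f \<in> poly_space t"
  shows "h * ((\<Sum>j<N. latitude_integral (y j) f) + (\<Sum>j<N. latitude_integral (y j) (f \<circ> swap_axes))) =
    8 * pi * (LINT x|normalized_surface_measure. f x)"
proof -
  define F where "F = {\<alpha> :: 3 \<Rightarrow> nat. (\<Sum>i\<in>UNIV. \<alpha> i) \<le> t}"
  have fin: "finite F" unfolding F_def by (rule finite_multi_indices)
  obtain c where fc: "f = (\<lambda>x. \<Sum>\<alpha>\<in>F. c \<alpha> * monomial \<alpha> x)"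
    using f unfolding poly_space_def F_def monomial_def by blast
  define s where "s \<alpha> = \<alpha>(1 := \<alpha> 3, 3 := \<alpha> 1)" for \<alpha> :: "3 \<Rightarrow> nat"
  have s: "s \<alpha> 1 = \<alpha> 3" "s \<alpha> 2 = \<alpha> 2" "s \<alpha> 3 = \<alpha> 1" for \<alpha> by (simp_all add: s_def)
  have swap: "f \<circ> swap_axes = (\<lambda>x. \<Sum>\<alpha>\<in>F. c \<alpha> * monomial (s \<alpha>) x)"
    by (rule ext) (simp add: fc monomial_eq s mult_ac)
  have deg: "\<alpha> 1 + \<alpha> 2 + \<alpha> 3 \<le> t" if "\<alpha> \<in> F" for \<alpha> using that by (simp add: F_def sum_3)
  have "h * (\<Sum>j<N. latitude_integral (y j) f) =
      (\<Sum>\<alpha>\<in>F. c \<alpha> * (h * (\<Sum>j<N. latitude_integral (y j) (monomial \<alpha>))))"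
    unfolding fc latitude_integral_sum[OF fin continuous_on_monomial] sum_distrib_left
    by (subst sum.swap) (simp add: mult_ac)
  also have "\<dots> = (\<Sum>\<alpha>\<in>F. c \<alpha> * sphere_moment (\<alpha> 1) (\<alpha> 2) (\<alpha> 3))"
    by (rule sum.cong[OF refl]) (simp only: latitude_integral_quadrature[OF Q deg])
  finally have 1: "h * (\<Sum>j<N. latitude_integral (y j) f) = (\<Sum>\<alpha>\<in>F. c \<alpha> * sphere_moment (\<alpha> 1) (\<alpha> 2) (\<alpha> 3))" .
  have "h * (\<Sum>j<N. latitude_integral (y j) (f \<circ> swap_axes)) =
      (\<Sum>\<alpha>\<in>F. c \<alpha> * (h * (\<Sum>j<N. latitude_integral (y j) (monomial (s \<alpha>)))))"
    unfolding swap latitude_integral_sum[OF fin continuous_on_monomial] sum_distrib_left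
    by (subst sum.swap) (simp add: mult_ac)
  also have "\<dots> = (\<Sum>\<alpha>\<in>F. c \<alpha> * sphere_moment (\<alpha> 1) (\<alpha> 2) (\<alpha> 3))"
  proof (rule sum.cong[OF refl])
    fix \<alpha> assume "\<alpha> \<in> F"
    then have "s \<alpha> 1 + s \<alpha> 2 + s \<alpha> 3 \<le> t" using deg[of \<alpha>] by (simp add: s)
    from latitude_integral_quadrature[OF Q this]
    show "c \<alpha> * (h * (\<Sum>j<N. latitude_integral (y j) (monomial (s \<alpha>)))) =
        c \<alpha> * sphere_moment (\<alpha> 1) (\<alpha> 2) (\<alpha> 3)"
      by (simp add: s sphere_moment_swap[of "\<alpha> 1"])
  qed
  finally have 2: "h * (\<Sum>j<N. latitude_integral (y j) (f \<circ> swap_axes)) =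
    (\<Sum>\<alpha>\<in>F. c \<alpha> * sphere_moment (\<alpha> 1) (\<alpha> 2) (\<alpha> 3))" .
  show ?thesis
    unfolding distrib_left 1 2 unfolding fc sphere_average_polynomial[OF fin] by simp
qed


section \<open>The design curves\<close>

text \<open>The circle \<open>?Z m\<close>, which is close to the equator, is the first curve. All circles \<open>?X j\<close> of the other family meet it
  and are inserted; then every remaining \<open>?Z j\<close> meets \<open>?X m\<close> and can be inserted too.\<close>

lemma design_curve_exists:
  fixes t :: nat
  defines "N \<equiv> 32 * Suc t + 1"
  shows "\<exists>g. sphere_curve g \<and> closed_curve g \<and> curve_length g = 8 * real N \<and>
    (\<forall>f\<in>poly_space t. 1 / curve_length g * curve_integral g f = (LINT x|normalized_surface_measure. f x)) \<and>
    (\<exists>\<C>. (\<forall>C\<in>\<C>. euclidean_circle C) \<and> path_image g = \<Union>\<C>)"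
proof -
  define h where "h = pi / real N"
  have N0: "real N > 0" by (simp add: N_def)
  have h0: "h > 0" using N0 by (simp add: h_def)
  have "\<exists>y. (\<forall>j. \<bar>y j - (real j + 1 / 2) * h\<bar> \<le> h / 4) \<and>
      (\<forall>k\<in>{1..Suc t}. h * (\<Sum>j<N. sin (real k * y j)) = integral {0..pi} (\<lambda>x. sin (real k * x)))"
    unfolding h_def by (rule equal_weight_sine_quadrature) (simp_all add: N_def)
  then obtain y where y': "\<forall>j. \<bar>y j - (real j + 1 / 2) * h\<bar> \<le> h / 4" and
    Qs: "\<forall>k\<in>{1..Suc t}. h * (\<Sum>j<N. sin (real k * y j)) = integral {0..pi} (\<lambda>x. sin (real k * x))"
    by blast
  note y = y'[rule_format]
  note Q = quadrature_sin_cos_powers[where n = "Suc t" and h = h and N = N and y = y, OF Qs[rule_format]]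
  have ylo: "h * (real j + 1 / 4) \<le> y j" and yhi: "y j \<le> h * (real j + 3 / 4)" for j
  proof -
    have "y j - (real j + 1 / 2) * h \<le> h / 4" "(real j + 1 / 2) * h - y j \<le> h / 4"
      using y[of j] by linarith+
    then show "h * (real j + 1 / 4) \<le> y j" "y j \<le> h * (real j + 3 / 4)" by (simp_all add: algebra_simps)
  qed
  have Nh: "real N * h = pi" using N0 by (simp add: h_def)
  have range: "h / 4 \<le> y j" "y j \<le> pi - h / 4" if "j < N" for j
  proof -
    have "h * (1 / 4) \<le> h * (real j + 1 / 4)" using h0 by (intro mult_left_mono) auto
    then show "h / 4 \<le> y j" using ylo[of j] by simp
    have "real j \<le> real N - 1" using that by linarith
    then have "h * (real j + 3 / 4) \<le> h * (real N - 1 / 4)" using h0 by (intro mult_left_mono) auto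
    then show "y j \<le> pi - h / 4" using yhi[of j] Nh by (simp add: algebra_simps)
  qed
  have pos: "sin (y j) > 0" if "j < N" for j
    using range[OF that] h0 by (intro sin_gt_zero) auto
  have less: "y i < y j" if "i < j" for i j
  proof -
    have "real i + 3 / 4 < real j + 1 / 4" using that by linarith
    then have "h * (real i + 3 / 4) < h * (real j + 1 / 4)" using h0 by (intro mult_strict_left_mono)
    then show ?thesis using yhi[of i] ylo[of j] by linarith
  qed
  have cos_neq: "cos (y i) \<noteq> cos (y j)" if "i < N" "j < N" "i \<noteq> j" for i j
  proof -
    have "y i \<noteq> y j" using less[of i j] less[of j i] that(3) by (cases "i < j") auto
    then show ?thesis
      using cos_inj_pi[of "y i" "y j"] range[OF that(1)] range[OF that(2)] h0 by auto
  qed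
  define m where "m = 16 * Suc t"
  have m: "m < N" by (simp add: m_def N_def)
  \<comment> \<open>The middle of cell \<open>m\<close> is \<open>\<pi> / 2\<close>. So \<open>\<bar>cos (y m)\<bar> \<le> sin (h / 4)\<close>, while all colatitudes keep the
    distance \<open>h / 4\<close> from the poles.\<close>
  have meet: "(cos (y m))\<^sup>2 + (cos (y j))\<^sup>2 \<le> 1" if j: "j < N" for j
  proof -
    have "(real m + 1 / 2) * h = pi / 2" using N0 by (simp add: m_def N_def h_def field_simps)
    then have ym: "\<bar>y m - pi / 2\<bar> \<le> h / 4" using y[of m] by (simp only:)
    have h4: "h / 4 \<le> pi / 2" using range[OF m] by linarith
    have "\<bar>sin (pi / 2 - y m)\<bar> \<le> sin (h / 4)"
    proof -
      have "sin (pi / 2 - y m) \<le> sin (h / 4)" "sin (- (h / 4)) \<le> sin (pi / 2 - y m)"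
        using ym h4 by (intro sin_monotone_2pi_le; linarith)+
      then show ?thesis by (simp add: abs_le_iff)
    qed
    then have "\<bar>cos (y m)\<bar> \<le> sin (h / 4)" by (simp add: cos_sin_eq)
    then have 1: "(cos (y m))\<^sup>2 \<le> (sin (h / 4))\<^sup>2" by (metis abs_ge_zero power2_abs power_mono)
    have "cos (y j) \<le> cos (h / 4)" "cos (pi - h / 4) \<le> cos (y j)"
      using range[OF j] h0 h4 pi_gt_zero by (intro cos_monotone_0_pi_le; linarith)+
    then have "\<bar>cos (y j)\<bar> \<le> cos (h / 4)" by (simp add: abs_le_iff)
    then have 2: "(cos (y j))\<^sup>2 \<le> (cos (h / 4))\<^sup>2" by (metis abs_ge_zero power2_abs power_mono)
    show ?thesis using 1 2 sin_cos_squared_add[of "h / 4"] by linarith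
  qed
  let ?Z = "\<lambda>j. latitude_circle 3 (y j)" and ?X = "\<lambda>j. latitude_circle 1 (y j)"
  let ?\<mu> = "\<lambda>j f. latitude_integral (y j) f" and ?\<nu> = "\<lambda>j f. latitude_integral (y j) (f \<circ> swap_axes)"
  have "\<exists>g. traverses g (?Z m \<union> (\<Union>j<N. ?X j)) (\<lambda>f. ?\<mu> m f + (\<Sum>j<N. ?\<nu> j f))"
  proof (rule traverses_UN)
    show "\<exists>g. traverses g (?Z m) (?\<mu> m)" using traverses_latitude_circle_3[OF pos[OF m]] by simp
    show "\<exists>c. traverses c (?X j) (?\<nu> j)" if "j \<in> {..<N}" for j
      using that by (intro traverses_latitude_circle_1 pos) simp
    show "finite (?Z m \<inter> ?X j) \<and> ?Z m \<inter> ?X j \<noteq> {}" if "j \<in> {..<N}" for j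
      using that by (intro conjI finite_latitude_circle_inter latitude_circle_inter_nonempty meet) simp
    show "finite (?X i \<inter> ?X j)" if "i \<in> {..<N}" "j \<in> {..<N}" "i \<noteq> j" for i j
      using that by (subst latitude_circle_disjoint) (simp_all add: cos_neq)
  qed simp
  then have "\<exists>g. traverses g ((?Z m \<union> (\<Union>j<N. ?X j)) \<union> (\<Union>j\<in>{..<N} - {m}. ?Z j))
      (\<lambda>f. (?\<mu> m f + (\<Sum>j<N. ?\<nu> j f)) + (\<Sum>j\<in>{..<N} - {m}. ?\<mu> j f))"
  proof (rule traverses_UN[rotated])
    show "\<exists>c. traverses c (?Z j) (?\<mu> j)" if "j \<in> {..<N} - {m}" for j
      using that traverses_latitude_circle_3[OF pos, of j] by simp
    have Zdisj: "?Z i \<inter> ?Z j = {}" if "i < N" "j < N" "i \<noteq> j" for i j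
      using that by (intro latitude_circle_disjoint cos_neq)
    show "finite (?Z i \<inter> ?Z j)" if "i \<in> {..<N} - {m}" "j \<in> {..<N} - {m}" "i \<noteq> j" for i j
      using that by (subst Zdisj) auto
    show "finite ((?Z m \<union> (\<Union>j<N. ?X j)) \<inter> ?Z j) \<and> (?Z m \<union> (\<Union>j<N. ?X j)) \<inter> ?Z j \<noteq> {}"
      if j: "j \<in> {..<N} - {m}" for j
    proof
      have "(?Z m \<union> (\<Union>i<N. ?X i)) \<inter> ?Z j = (?Z m \<inter> ?Z j) \<union> (\<Union>i<N. ?Z j \<inter> ?X i)" by blast
      moreover have "?Z m \<inter> ?Z j = {}" using Zdisj[of m j] m j by auto
      moreover have "finite (\<Union>i<N. ?Z j \<inter> ?X i)" by (intro finite_UN_I finite_latitude_circle_inter) simp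
      ultimately show "finite ((?Z m \<union> (\<Union>i<N. ?X i)) \<inter> ?Z j)" by simp
      have "?Z j \<inter> ?X m \<noteq> {}"
        using meet[of j] j by (intro latitude_circle_inter_nonempty) (simp add: add.commute)
      then show "(?Z m \<union> (\<Union>i<N. ?X i)) \<inter> ?Z j \<noteq> {}" using m by blast
    qed
  qed simp
  then obtain g where g: "traverses g ((?Z m \<union> (\<Union>j<N. ?X j)) \<union> (\<Union>j\<in>{..<N} - {m}. ?Z j))
      (\<lambda>f. (?\<mu> m f + (\<Sum>j<N. ?\<nu> j f)) + (\<Sum>j\<in>{..<N} - {m}. ?\<mu> j f))" by blast
  have im: "path_image g = \<Union>(?Z ` {..<N} \<union> ?X ` {..<N})"
    using g m unfolding traverses_def by auto
  have ci: "h * curve_integral g f = 8 * pi * (LINT x|normalized_surface_measure. f x)" if f: "f \<in> poly_space t" for f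
  proof -
    have "continuous_on UNIV f"
    proof -
      obtain c where "f = (\<lambda>x. \<Sum>\<alpha> | (\<Sum>i\<in>UNIV. \<alpha> i) \<le> t. c \<alpha> * (\<Prod>i\<in>UNIV. (x $ i) ^ \<alpha> i))"
        using f unfolding poly_space_def by blast
      then show ?thesis by (simp only:) (intro continuous_intros)
    qed
    then have "curve_integral g f = (?\<mu> m f + (\<Sum>j<N. ?\<nu> j f)) + (\<Sum>j\<in>{..<N} - {m}. ?\<mu> j f)"
      using g unfolding traverses_def by (intro curve_integral_eq_arc_integral) blast
    also have "\<dots> = (\<Sum>j<N. ?\<mu> j f) + (\<Sum>j<N. ?\<nu> j f)"
      using m by (subst sum.remove[of "{..<N}" m "\<lambda>j. ?\<mu> j f"]) simp_all
    finally show ?thesis using latitude_circles_exact[OF Q f] by simp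
  qed
  have len: "curve_length g = 8 * real N"
  proof -
    have one: "(\<lambda>_. 1) \<in> poly_space t"
      unfolding poly_space_def
      by (intro CollectI exI[of _ "\<lambda>\<alpha>. if \<alpha> = (\<lambda>_. 0) then 1 else 0"] ext)
        (simp add: if_distrib[of "\<lambda>c. c * _"] sum.delta[OF finite_multi_indices] cong: if_cong)
    have "curve_length g = curve_integral g (\<lambda>_. 1)"
      unfolding curve_length_def curve_integral_def by simp
    moreover have "(LINT x|normalized_surface_measure. (1 :: real)) = 1"
    proof -
      have "(sin has_integral (- cos pi) - (- cos 0)) {0..pi}"
        by (intro fundamental_theorem_of_calculus)
          (auto simp: has_real_derivative_iff_has_vector_derivative[symmetric] intro!: derivative_eq_intros)
      then have "integral {0..pi} sin = 2" by (simp add: integral_unique)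
      then show ?thesis by (subst integral_normalized_surface_measure) simp_all
    qed
    ultimately have "h * curve_length g = 8 * pi" using ci[OF one] by simp
    then show ?thesis using N0 h0 by (simp add: h_def field_simps)
  qed
  have "path_image g \<subseteq> sphere 0 1" unfolding im by (auto simp: latitude_circle_def)
  then have "sphere_curve g" "closed_curve g"
    using g N0 unfolding traverses_def sphere_curve_def len by auto
  moreover have "1 / curve_length g * curve_integral g f = (LINT x|normalized_surface_measure. f x)"
    if "f \<in> poly_space t" for f
    using ci[OF that] N0 unfolding len h_def by (simp add: field_simps)
  moreover have "\<forall>C\<in>?Z ` {..<N} \<union> ?X ` {..<N}. euclidean_circle C"
    using pos by (auto intro!: euclidean_circle_latitude)
  ultimately show ?thesis using len im by blast
qed

theorem theorem5p1:
  shows "\<exists>\<gamma> :: nat \<Rightarrow> real \<Rightarrow> real^3.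
    (\<forall>t\<ge>1. sphere_curve (\<gamma> t) \<and> closed_curve (\<gamma> t)) \<and>
    (\<exists>c C :: real. 0 < c \<and> c \<le> C \<and>
       (\<forall>t\<ge>1. c * real t \<le> curve_length (\<gamma> t) \<and> curve_length (\<gamma> t) \<le> C * real t)) \<and>
    (\<forall>t\<ge>1. \<forall>f\<in>poly_space t.
       1 / curve_length (\<gamma> t) * curve_integral (\<gamma> t) f =
       (LINT x|normalized_surface_measure. f x)) \<and>
    (\<forall>t\<ge>1. \<exists>\<C>. (\<forall>C\<in>\<C>. euclidean_circle C) \<and> path_image (\<gamma> t) = \<Union>\<C>)"
proof -
  obtain \<gamma> :: "nat \<Rightarrow> real \<Rightarrow> real^3" where \<gamma>:
    "\<And>t. sphere_curve (\<gamma> t)" "\<And>t. closed_curve (\<gamma> t)"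
    "\<And>t. curve_length (\<gamma> t) = 8 * real (32 * Suc t + 1)"
    "\<And>t f. f \<in> poly_space t \<Longrightarrow> 1 / curve_length (\<gamma> t) * curve_integral (\<gamma> t) f =
       (LINT x|normalized_surface_measure. f x)"
    "\<And>t. \<exists>\<C>. (\<forall>C\<in>\<C>. euclidean_circle C) \<and> path_image (\<gamma> t) = \<Union>\<C>"
    using design_curve_exists by metis
  \<comment> \<open>The length is \<open>256 t + 264\<close>, and \<open>264 \<le> 264 t\<close>.\<close>
  have "256 * real t \<le> curve_length (\<gamma> t) \<and> curve_length (\<gamma> t) \<le> 520 * real t" if "t \<ge> 1" for t
    using that by (simp add: \<gamma>(3))
  then have len: "\<exists>c C :: real. 0 < c \<and> c \<le> C \<and>
       (\<forall>t\<ge>1. c * real t \<le> curve_length (\<gamma> t) \<and> curve_length (\<gamma> t) \<le> C * real t)"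
    by (intro exI[of _ 256] exI[of _ 520]) auto
  show ?thesis
    using \<gamma>(1,2,4,5) len by (intro exI[of _ \<gamma>] conjI allI impI ballI)
qed

end
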